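(* For every $k\in\{2,3,4,\dots\}$, $\mathbb F^\infty(k)$ is completely isomorphic to $\mathbb F^\infty(\infty)$.
   Context: For $k\in\{1,2,\dots\}\cup\{\infty\}$, let $P_k$ be the free semigroup of words in positive powers of $k$ letters (including the empty word), $\ell_2(P_k)$ the Hilbert space with orthonormal basis $\{\delta_x:x\in P_k\}$, and $L_x\delta_y=\delta_{xy}$. $\mathbb F^\infty(k)$ is the strong operator closure of $\mathrm{span}\{L_x:x\in P_k\}$ in $B(\ell_2(P_k))$. Completely isomorphic means related by a linear bijection which is completely bounded with completely bounded inverse. *)

theory Defs
  imports "HOL-Analysis.Analysis" "HOL-Library.Extended_Nat"
begin

(* Letters are natural numbers; the alphabet of P_k is {0..<k} (all of nat for k = \<infinity>).
   Words are lists; the empty list is the empty word; concatenation xy is x @ y. *)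
definition words :: "enat \<Rightarrow> nat list set" where
  "words K = {w. \<forall>a\<in>set w. enat a < K}"

definition l2 :: "enat \<Rightarrow> (nat list \<Rightarrow> complex) set" where
  "l2 K = {f. (\<forall>w. w \<notin> words K \<longrightarrow> f w = 0) \<and>
              (\<lambda>w. (cmod (f w))^2) summable_on UNIV}"

definition nrm :: "(nat list \<Rightarrow> complex) \<Rightarrow> real" where
  "nrm f = sqrt (infsum (\<lambda>w. (cmod (f w))^2) UNIV)"

type_synonym op = "(nat list \<Rightarrow> complex) \<Rightarrow> (nat list \<Rightarrow> complex)"

(* bounded linear operators on ell_2(P_k), represented extensionally (zero off ell_2) *)
definition is_op :: "enat \<Rightarrow> op \<Rightarrow> bool" where
  "is_op K T \<longleftrightarrow>
     (\<forall>f\<in>l2 K. T f \<in> l2 K) \<and>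
     (\<forall>f. f \<notin> l2 K \<longrightarrow> T f = (\<lambda>_. 0)) \<and>
     (\<forall>f\<in>l2 K. \<forall>g\<in>l2 K. \<forall>a b. T (\<lambda>w. a * f w + b * g w) = (\<lambda>w. a * T f w + b * T g w)) \<and>
     (\<exists>C. \<forall>f\<in>l2 K. nrm (T f) \<le> C * nrm f)"

(* left creation operator L_x: L_x delta_y = delta_{xy} *)
definition Lop :: "enat \<Rightarrow> nat list \<Rightarrow> op" where
  "Lop K x f = (if f \<in> l2 K then (\<lambda>w. if take (length x) w = x then f (drop (length x) w) else 0)
                else (\<lambda>_. 0))"

definition Lspan :: "enat \<Rightarrow> op set" where
  "Lspan K = {T. \<exists>A c. finite A \<and> A \<subseteq> words K \<and>
                  T = (\<lambda>f w. \<Sum>x\<in>A. c x * Lop K x f w)}"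

(* F^\<infinity>(k): strong operator closure of Lspan in B(ell_2(P_k)) *)
definition Falg :: "enat \<Rightarrow> op set" where
  "Falg K = {T. is_op K T \<and>
      (\<forall>F. finite F \<longrightarrow> F \<subseteq> l2 K \<longrightarrow> (\<forall>e>0. \<exists>S\<in>Lspan K. \<forall>f\<in>F.
           nrm (\<lambda>w. T f w - S f w) < e))}"

(* norm of an n x n operator matrix acting on ell_2(P_k)^n, i.e. the norm in M_n(B(ell_2(P_k))) *)
definition mnorm :: "enat \<Rightarrow> nat \<Rightarrow> (nat \<Rightarrow> nat \<Rightarrow> op) \<Rightarrow> real" where
  "mnorm K n T = Sup {sqrt (\<Sum>i<n. (nrm (\<lambda>w. \<Sum>j<n. T i j (f j) w))^2) | f.
                       (\<forall>j<n. f j \<in> l2 K) \<and> (\<Sum>j<n. (nrm (f j))^2) \<le> 1}"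

definition op_lincomb :: "complex \<Rightarrow> op \<Rightarrow> complex \<Rightarrow> op \<Rightarrow> op" where
  "op_lincomb a T b S = (\<lambda>f w. a * T f w + b * S f w)"

definition lin_on :: "enat \<Rightarrow> (op \<Rightarrow> op) \<Rightarrow> bool" where
  "lin_on K \<phi> \<longleftrightarrow> (\<forall>T\<in>Falg K. \<forall>S\<in>Falg K. \<forall>a b.
      \<phi> (op_lincomb a T b S) = op_lincomb a (\<phi> T) b (\<phi> S))"

definition cb_map :: "enat \<Rightarrow> enat \<Rightarrow> (op \<Rightarrow> op) \<Rightarrow> bool" where
  "cb_map K1 K2 \<phi> \<longleftrightarrow> (\<exists>C. \<forall>n T. (\<forall>i<n. \<forall>j<n. T i j \<in> Falg K1) \<longrightarrow>
      mnorm K2 n (\<lambda>i j. \<phi> (T i j)) \<le> C * mnorm K1 n T)"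

definition completely_isomorphic :: "enat \<Rightarrow> enat \<Rightarrow> bool" where
  "completely_isomorphic K1 K2 \<longleftrightarrow> (\<exists>\<phi> \<psi>.
      (\<forall>T\<in>Falg K1. \<phi> T \<in> Falg K2) \<and> (\<forall>S\<in>Falg K2. \<psi> S \<in> Falg K1) \<and>
      (\<forall>T\<in>Falg K1. \<psi> (\<phi> T) = T) \<and> (\<forall>S\<in>Falg K2. \<phi> (\<psi> S) = S) \<and>
      lin_on K1 \<phi> \<and> lin_on K2 \<psi> \<and> cb_map K1 K2 \<phi> \<and> cb_map K2 K1 \<psi>)"

end

theory Submission
  imports Defs
begin

text \<open>
  Write \<open>X\<^sub>k\<close> for \<open>\<bbbF>\<^sup>\<infinity>(k)\<close>. An operator \<open>T\<close> in \<open>X\<^sub>k\<close> is left convolution by its coefficient function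
  \<open>T \<delta>\<^bsub>[]\<^esub>\<close>, so maps between these algebras can be given by bijections of words.
  If \<open>S\<close> is a free subsemigroup of \<open>P\<^sub>k\<close> generated by a bifix code and \<open>y\<^sub>0, y\<^sub>1, \<dots>\<close> is a prefix code
  compatible with \<open>S\<close>, the functions supported on the union of the \<open>y\<^sub>l S\<close> form a completely
  complemented subspace, completely isometric to an infinite column over the algebra of \<open>S\<close>.
  Shifting \<open>y\<^sub>l\<close> to \<open>y\<^bsub>l+1\<^esub>\<close> therefore gives \<open>X\<^sub>k \<simeq> X\<^sub>\<infinity> \<oplus> X\<^sub>k\<close> (words \<open>0 1\<^sup>i 0\<close> generate \<open>S\<close>, \<open>y\<^sub>l = 1\<^sup>l 0\<close>)
  and likewise \<open>X\<^sub>\<infinity> \<simeq> X\<^sub>k \<oplus> X\<^sub>\<infinity>\<close> (\<open>S = P\<^sub>k\<close>, \<open>y\<^sub>l\<close> the letter \<open>k + l\<close>), whence \<open>X\<^sub>k \<simeq> X\<^sub>\<infinity>\<close>.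
\<close>

section \<open>Bounds for matrices of left multipliers\<close>

definition splits :: "'a list \<Rightarrow> ('a list \<times> 'a list) set" where
  "splits w = {(u, v). u @ v = w}"

lemma splits_eq_image: "splits w = (\<lambda>m. (take m w, drop m w)) ` {..length w}"
proof -
  have "(u, v) \<in> (\<lambda>m. (take m w, drop m w)) ` {..length w}" if "u @ v = w" for u v
    using that by (intro image_eqI[of _ _ "length u"]) auto
  then show ?thesis
    by (auto simp: splits_def)
qed

lemma finite_splits [simp]: "finite (splits w)"
  by (simp add: splits_eq_image)

definition conv :: "(nat list \<Rightarrow> complex) \<Rightarrow> (nat list \<Rightarrow> complex) \<Rightarrow> nat list \<Rightarrow> complex" where
  "conv f g w = (\<Sum>(u, v)\<in>splits w. f u * g v)"

text \<open>\<open>mbound K n F C\<close>: the matrix of left convolutions by the \<open>F i j\<close> has norm at most \<open>C\<close>. Testing on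
  finitely supported vectors and finitely many output words suffices, and keeps all sums finite.\<close>

definition mbound :: "enat \<Rightarrow> nat \<Rightarrow> (nat \<Rightarrow> nat \<Rightarrow> nat list \<Rightarrow> complex) \<Rightarrow> real \<Rightarrow> bool" where
  "mbound K n F C \<longleftrightarrow> 0 \<le> C \<and>
     (\<forall>G V W. finite V \<longrightarrow> finite W \<longrightarrow> V \<subseteq> words K \<longrightarrow> (\<forall>j v. v \<notin> V \<longrightarrow> G j v = 0) \<longrightarrow>
        (\<Sum>w\<in>W. \<Sum>i<n. (cmod (\<Sum>j<n. conv (F i j) (G j) w))\<^sup>2)
          \<le> C\<^sup>2 * (\<Sum>v\<in>V. \<Sum>j<n. (cmod (G j v))\<^sup>2))"

lemma mboundD:
  assumes "mbound K n F C" "finite V" "finite W" "V \<subseteq> words K" "\<And>j v. v \<notin> V \<Longrightarrow> G j v = 0"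
  shows "(\<Sum>w\<in>W. \<Sum>i<n. (cmod (\<Sum>j<n. conv (F i j) (G j) w))\<^sup>2)
          \<le> C\<^sup>2 * (\<Sum>v\<in>V. \<Sum>j<n. (cmod (G j v))\<^sup>2)"
  using assms unfolding mbound_def by blast

section \<open>Codes and the factorization of words along them\<close>

lemma words_Nil [simp]: "[] \<in> words K"
  by (simp add: words_def)

lemma words_append [simp]: "u @ v \<in> words K \<longleftrightarrow> u \<in> words K \<and> v \<in> words K"
  by (auto simp: words_def)

text \<open>The image of \<open>\<iota>\<close> is a free subsemigroup: \<open>pre\<close> says that
  removing an image prefix from an image word leaves an image word. \<open>suf\<close> is the mirror
  condition along each row \<open>y l\<close>: an image suffix of \<open>y l @ \<iota> s\<close>
  never cuts into \<open>y l\<close>. \<open>ypre\<close> makes different \<open>y l\<close>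
  incomparable as prefixes.\<close>

locale code_block =
  fixes A :: enat and \<iota> :: "nat list \<Rightarrow> nat list" and I :: "nat set" and y :: "nat \<Rightarrow> nat list"
  assumes hom: "s \<in> words A \<Longrightarrow> t \<in> words A \<Longrightarrow> \<iota> (s @ t) = \<iota> s @ \<iota> t"
    and inj: "s \<in> words A \<Longrightarrow> t \<in> words A \<Longrightarrow> \<iota> s = \<iota> t \<longleftrightarrow> s = t"
    and pre: "s \<in> words A \<Longrightarrow> t \<in> words A \<Longrightarrow> \<iota> s @ x = \<iota> t \<Longrightarrow> \<exists>p\<in>words A. x = \<iota> p"
    and suf: "l \<in> I \<Longrightarrow> s \<in> words A \<Longrightarrow> t \<in> words A \<Longrightarrow> u @ \<iota> t = y l @ \<iota> s \<Longrightarrow>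
                \<exists>p\<in>words A. u = y l @ \<iota> p"
    and ypre: "l \<in> I \<Longrightarrow> m \<in> I \<Longrightarrow> y l @ a = y m @ b \<Longrightarrow> l = m"
begin

lemma emb_Nil [simp]: "\<iota> [] = []"
  using hom[of "[]" "[]"] by simp

lemma emb_eq_Nil: "s \<in> words A \<Longrightarrow> \<iota> s = [] \<longleftrightarrow> s = []"
  using inj[of s "[]"] by simp

text \<open>Rigid words form a transversal for left multiplication by the image of
  \<open>\<iota>\<close>: they represent the remainders after all image prefixes have been
  stripped.\<close>

definition rigid :: "nat list set" where
  "rigid = {r. \<forall>p\<in>words A. \<forall>x. r = \<iota> p @ x \<longrightarrow> p = []}"

text \<open>A word that is not rigid has a nonempty image prefix; stripping it shortens the word, so
  the process stops at a rigid remainder.\<close>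

lemma rigid_factorization: "\<exists>t\<in>words A. \<exists>r\<in>rigid. v = \<iota> t @ r"
proof (induction v rule: length_induct)
  case (1 v)
  show ?case
  proof (cases "v \<in> rigid")
    case True
    then show ?thesis by (intro bexI[of _ "[]"] bexI[of _ v]) auto
  next
    case False
    then obtain p x where p: "p \<in> words A" "v = \<iota> p @ x" "p \<noteq> []"
      by (auto simp: rigid_def)
    then have "length x < length v"
      by (simp add: emb_eq_Nil)
    then obtain t r where "t \<in> words A" "r \<in> rigid" "x = \<iota> t @ r"
      using 1 by blast
    with p show ?thesis
      by (intro bexI[of _ "p @ t"] bexI[of _ r]) (auto simp: hom)
  qed
qed

text \<open>Compare the lengths of \<open>\<iota> t\<close> and \<open>\<iota> p\<close>. If
  \<open>\<iota> t\<close> is longer, \<open>pre\<close> makes the overhang an image prefix of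
  \<open>r\<close>, hence empty by rigidity. If \<open>\<iota> p\<close> is longer,
  \<open>pre\<close> turns the overhang into \<open>\<iota> q\<close>.\<close>

lemma rigid_prefix:
  assumes "t \<in> words A" "p \<in> words A" "r \<in> rigid" "\<iota> t @ x = \<iota> p @ r"
  shows "\<exists>q\<in>words A. p = t @ q \<and> x = \<iota> q @ r"
proof -
  from assms(4) consider us where "\<iota> t = \<iota> p @ us" "us @ x = r"
    | us where "\<iota> t @ us = \<iota> p" "x = us @ r"
    by (auto simp: append_eq_append_conv2)
  then show ?thesis
  proof cases
    case 1
    then obtain q where q: "q \<in> words A" "us = \<iota> q"
      using pre[of p t us] assms by metis
    then have "q = []"
      using assms(3) 1 unfolding rigid_def by blast
    then show ?thesis
      using 1 q assms by (intro bexI[of _ "[]"]) (auto simp: inj)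
  next
    case 2
    then obtain q where q: "q \<in> words A" "us = \<iota> q"
      using pre[of t p us] assms by metis
    then have "\<iota> p = \<iota> (t @ q)"
      using 2 hom assms by simp
    then have "p = t @ q"
      using inj[of p "t @ q"] assms q by simp
    with 2 q show ?thesis by blast
  qed
qed

lemma rigid_unique:
  assumes "t \<in> words A" "p \<in> words A" "r \<in> rigid" "r' \<in> rigid" "\<iota> t @ r = \<iota> p @ r'"
  shows "t = p \<and> r = r'"
proof -
  obtain q where q: "q \<in> words A" "p = t @ q" "r = \<iota> q @ r'"
    using rigid_prefix[OF assms(1,2,4,5)] by blast
  then have "q = []"
    using assms(3) unfolding rigid_def by blast
  with q show ?thesis by simp
qed

end

text \<open>Every word is uniquely \<open>\<kappa> t @ r\<close> with \<open>r\<close> rigid. Splitting the target space along \<open>r\<close> turns the new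
  multiplier into a direct sum of compressions of the old one, so the norm does not increase.\<close>

lemma mbound_transfer:
  assumes src: "code_block A \<iota> I y" and tgt: "code_block A \<kappa> I z"
    and emb: "\<And>s. s \<in> words A \<Longrightarrow> \<iota> s \<in> words K"
    and bd: "mbound K n F C"
    and F': "\<And>i j l s. l \<in> I \<Longrightarrow> s \<in> words A \<Longrightarrow> F' i j (z l @ \<kappa> s) = F i j (y l @ \<iota> s)"
    and F'0: "\<And>i j w. (\<And>l s. l \<in> I \<Longrightarrow> s \<in> words A \<Longrightarrow> w \<noteq> z l @ \<kappa> s) \<Longrightarrow> F' i j w = 0"
  shows "mbound M n F' C"
  unfolding mbound_def
proof (intro conjI allI impI)
  show "0 \<le> C" using bd by (simp add: mbound_def)
next
  fix G :: "nat \<Rightarrow> nat list \<Rightarrow> complex" and V W :: "nat list set"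
  assume V: "finite V" and W: "finite W" and G0: "\<forall>j v. v \<notin> V \<longrightarrow> G j v = 0"
  interpret S: code_block A \<iota> I y by (rule src)
  interpret T: code_block A \<kappa> I z by (rule tgt)
  \<comment> \<open>Only these output words can be reached by the new multiplier; the convolution
    vanishes on the rest of \<open>W\<close>.\<close>
  define W' where "W' = {w \<in> W. \<exists>l\<in>I. \<exists>p\<in>words A. \<exists>r\<in>T.rigid. w = z l @ \<kappa> p @ r}"
  have "\<forall>w\<in>W'. \<exists>l p r. l \<in> I \<and> p \<in> words A \<and> r \<in> T.rigid \<and> w = z l @ \<kappa> p @ r"
    by (auto simp: W'_def)
  then obtain L P R where dec: "\<And>w. w \<in> W' \<Longrightarrow> L w \<in> I" "\<And>w. w \<in> W' \<Longrightarrow> P w \<in> words A"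
      "\<And>w. w \<in> W' \<Longrightarrow> R w \<in> T.rigid" "\<And>w. w \<in> W' \<Longrightarrow> w = z (L w) @ \<kappa> (P w) @ R w"
    by metis
  \<comment> \<open>The slice of \<open>G\<close> over the remainder \<open>r\<close>, moved to the
    image of \<open>\<iota>\<close>. The value 0 off that image is what makes the old multiplier
    appear only as a compression.\<close>
  define Gr where "Gr r j x = (if x \<in> \<iota> ` words A then G j (\<kappa> (inv_into (words A) \<iota> x) @ r) else 0)" for r j x
  have Gr: "Gr r j (\<iota> t) = G j (\<kappa> t @ r)" if "t \<in> words A" for r j t
    using that S.inj by (simp add: Gr_def inv_into_f_f inj_on_def)
  have Gr0: "Gr r j x = 0" if "x \<notin> \<iota> ` words A" for r j x
    using that by (simp add: Gr_def)
  have zero: "conv (F' i j) (G j) w = 0" if w: "w \<in> W - W'" for i j w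
    unfolding conv_def
  proof (rule sum.neutral, clarify)
    fix u v assume uv: "(u, v) \<in> splits w"
    have "u \<noteq> z l @ \<kappa> s" if "l \<in> I" "s \<in> words A" for l s
    proof
      assume u: "u = z l @ \<kappa> s"
      obtain t r where "t \<in> words A" "r \<in> T.rigid" "v = \<kappa> t @ r"
        using T.rigid_factorization by blast
      then have "w = z l @ \<kappa> (s @ t) @ r" "s @ t \<in> words A" "r \<in> T.rigid"
        using uv u that by (auto simp: splits_def T.hom)
      then show False using w that(1) unfolding W'_def by blast
    qed
    then show "F' i j u * G j v = 0" by (simp add: F'0)
  qed
  \<comment> \<open>Both convolutions collapse to a sum over the splits of \<open>p\<close>: on the
    target side because \<open>F'\<close> lives on the code and \<open>rigid_prefix\<close> applies,
    on the source side because \<open>Gr\<close> vanishes off the image and \<open>suf\<close>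
    applies.\<close>
  have key: "conv (F' i j) (G j) (z l @ \<kappa> p @ r) = conv (F i j) (Gr r j) (y l @ \<iota> p)"
    if l: "l \<in> I" and p: "p \<in> words A" and r: "r \<in> T.rigid" for i j l p r
  proof -
    have spA: "s \<in> words A \<and> t \<in> words A" if "(s, t) \<in> splits p" for s t
      using that p by (auto simp: splits_def)
    have injT: "inj_on (\<lambda>(s, t). (z l @ \<kappa> s, \<kappa> t @ r)) (splits p)"
      using spA by (intro inj_onI) (auto simp: T.inj)
    have injS: "inj_on (\<lambda>(s, t). (y l @ \<iota> s, \<iota> t)) (splits p)"
      using spA by (intro inj_onI) (auto simp: S.inj)
    have "conv (F' i j) (G j) (z l @ \<kappa> p @ r)
        = (\<Sum>(u, v)\<in>(\<lambda>(s, t). (z l @ \<kappa> s, \<kappa> t @ r)) ` splits p. F' i j u * G j v)"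
      unfolding conv_def
    proof (rule sum.mono_neutral_right)
      show "(\<lambda>(s, t). (z l @ \<kappa> s, \<kappa> t @ r)) ` splits p \<subseteq> splits (z l @ \<kappa> p @ r)"
        using p by (auto simp: splits_def T.hom)
      show "\<forall>x\<in>splits (z l @ \<kappa> p @ r) - (\<lambda>(s, t). (z l @ \<kappa> s, \<kappa> t @ r)) ` splits p.
         (case x of (u, v) \<Rightarrow> F' i j u * G j v) = 0"
      proof clarify
        fix u v assume uv: "(u, v) \<in> splits (z l @ \<kappa> p @ r)"
          and n: "(u, v) \<notin> (\<lambda>(s, t). (z l @ \<kappa> s, \<kappa> t @ r)) ` splits p"
        have "u \<noteq> z m @ \<kappa> s" if m: "m \<in> I" "s \<in> words A" for m s
        proof
          assume u: "u = z m @ \<kappa> s"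
          with uv have e: "z m @ (\<kappa> s @ v) = z l @ (\<kappa> p @ r)" by (simp add: splits_def)
          with T.ypre[OF m(1) l] have "m = l" by blast
          with e have "\<kappa> s @ v = \<kappa> p @ r" by simp
          then obtain q where "q \<in> words A" "p = s @ q" "v = \<kappa> q @ r"
            using T.rigid_prefix[OF m(2) p r] by blast
          then have "(s, q) \<in> splits p" "(u, v) = (z l @ \<kappa> s, \<kappa> q @ r)"
            using u \<open>m = l\<close> by (auto simp: splits_def)
          then show False using n by force
        qed
        then show "F' i j u * G j v = 0" by (simp add: F'0)
      qed
    qed simp
    also have "\<dots> = (\<Sum>(s, t)\<in>splits p. F' i j (z l @ \<kappa> s) * G j (\<kappa> t @ r))"
      by (subst sum.reindex[OF injT]) (simp add: case_prod_unfold o_def)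
    also have "\<dots> = (\<Sum>(s, t)\<in>splits p. F i j (y l @ \<iota> s) * Gr r j (\<iota> t))"
      using spA l by (intro sum.cong) (auto simp: F' Gr)
    also have "\<dots> = (\<Sum>(u, v)\<in>(\<lambda>(s, t). (y l @ \<iota> s, \<iota> t)) ` splits p. F i j u * Gr r j v)"
      by (subst sum.reindex[OF injS]) (simp add: case_prod_unfold o_def)
    also have "\<dots> = conv (F i j) (Gr r j) (y l @ \<iota> p)"
      unfolding conv_def
    proof (rule sum.mono_neutral_left)
      show "(\<lambda>(s, t). (y l @ \<iota> s, \<iota> t)) ` splits p \<subseteq> splits (y l @ \<iota> p)"
        using p by (auto simp: splits_def S.hom)
      show "\<forall>x\<in>splits (y l @ \<iota> p) - (\<lambda>(s, t). (y l @ \<iota> s, \<iota> t)) ` splits p.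
         (case x of (u, v) \<Rightarrow> F i j u * Gr r j v) = 0"
      proof clarify
        fix u v assume uv: "(u, v) \<in> splits (y l @ \<iota> p)"
          and n: "(u, v) \<notin> (\<lambda>(s, t). (y l @ \<iota> s, \<iota> t)) ` splits p"
        have "v \<notin> \<iota> ` words A"
        proof
          assume "v \<in> \<iota> ` words A"
          then obtain t where t: "t \<in> words A" "v = \<iota> t" by blast
          with uv have e: "u @ \<iota> t = y l @ \<iota> p" by (simp add: splits_def)
          then obtain s where s: "s \<in> words A" "u = y l @ \<iota> s"
            using S.suf[OF l p t(1)] by blast
          with e have "\<iota> (s @ t) = \<iota> p" using t by (simp add: S.hom)
          then have "s @ t = p" using S.inj s t p by simp
          then show False using n s t by (force simp: splits_def)
        qed
        then show "F i j u * Gr r j v = 0" by (simp add: Gr0)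
      qed
    qed simp
    finally show ?thesis .
  qed
  let ?q = "\<lambda>w. \<Sum>i<n. (cmod (\<Sum>j<n. conv (F' i j) (G j) w))\<^sup>2"
  let ?g = "\<lambda>v. \<Sum>j<n. (cmod (G j v))\<^sup>2"
  define Vr where "Vr r = {t \<in> words A. \<kappa> t @ r \<in> V}" for r
  have inj\<kappa>: "inj_on (\<lambda>t. \<kappa> t @ r) (Vr r)" for r
    by (rule inj_onI) (auto simp: Vr_def T.inj)
  have finVr: "finite (Vr r)" for r
    using inj\<kappa> by (rule inj_on_finite[where B = V]) (auto simp: Vr_def V)
  have inj\<iota>: "inj_on \<iota> (Vr r)" for r
    by (rule inj_onI) (auto simp: Vr_def S.inj)
  have W'fin: "finite W'" using W by (simp add: W'_def)
  \<comment> \<open>One application of the old bound for each remainder. For fixed \<open>r\<close>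
    the output words correspond injectively to words \<open>y l @ \<iota> p\<close> of the
    source.\<close>
  have fibre: "(\<Sum>w\<in>{w\<in>W'. R w = r}. ?q w) \<le> C\<^sup>2 * (\<Sum>v\<in>(\<lambda>t. \<kappa> t @ r) ` Vr r. ?g v)"
    if r: "r \<in> R ` W'" for r
  proof -
    let ?X = "{w\<in>W'. R w = r}"
    let ?\<theta> = "\<lambda>w. y (L w) @ \<iota> (P w)"
    have inj: "inj_on ?\<theta> ?X"
    proof (rule inj_onI)
      fix w w' assume w: "w \<in> ?X" "w' \<in> ?X" and e: "?\<theta> w = ?\<theta> w'"
      have "L w = L w'" using S.ypre dec(1) w e by blast
      with e have "\<iota> (P w) = \<iota> (P w')" by simp
      then have "P w = P w'" using S.inj dec(2) w by blast
      then show "w = w'" using dec(4)[of w] dec(4)[of w'] w \<open>L w = L w'\<close> by simp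
    qed
    have "(\<Sum>w\<in>?X. ?q w) = (\<Sum>w\<in>?X. \<Sum>i<n. (cmod (\<Sum>j<n. conv (F i j) (Gr r j) (?\<theta> w)))\<^sup>2)"
    proof (rule sum.cong)
      fix w assume "w \<in> ?X"
      then have w: "w \<in> W'" "R w = r" by auto
      have "conv (F' i j) (G j) w = conv (F i j) (Gr r j) (?\<theta> w)" for i j
        using key[OF dec(1-3)[OF w(1)], of i j] dec(4)[OF w(1)] w(2) by simp
      then show "?q w = (\<Sum>i<n. (cmod (\<Sum>j<n. conv (F i j) (Gr r j) (?\<theta> w)))\<^sup>2)" by simp
    qed simp
    also have "\<dots> = (\<Sum>x\<in>?\<theta> ` ?X. \<Sum>i<n. (cmod (\<Sum>j<n. conv (F i j) (Gr r j) x))\<^sup>2)"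
      by (simp add: sum.reindex[OF inj])
    also have "\<dots> \<le> C\<^sup>2 * (\<Sum>x\<in>\<iota> ` Vr r. \<Sum>j<n. (cmod (Gr r j x))\<^sup>2)"
    proof (rule mboundD[OF bd])
      show "\<iota> ` Vr r \<subseteq> words K" using emb by (auto simp: Vr_def)
      fix j x assume x: "x \<notin> \<iota> ` Vr r"
      show "Gr r j x = 0"
      proof (cases "x \<in> \<iota> ` words A")
        case True
        then obtain t where t: "t \<in> words A" "x = \<iota> t" by blast
        with x have "\<kappa> t @ r \<notin> V" by (auto simp: Vr_def)
        then show ?thesis using t Gr G0 by simp
      qed (rule Gr0)
    qed (use finVr W'fin in auto)
    also have "(\<Sum>x\<in>\<iota> ` Vr r. \<Sum>j<n. (cmod (Gr r j x))\<^sup>2) = (\<Sum>v\<in>(\<lambda>t. \<kappa> t @ r) ` Vr r. ?g v)"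
      by (simp add: sum.reindex[OF inj\<iota>] sum.reindex[OF inj\<kappa>]) (auto simp: Vr_def Gr intro!: sum.cong)
    finally show ?thesis .
  qed
  have "(\<Sum>w\<in>W. ?q w) = (\<Sum>w\<in>W'. ?q w)"
    using zero by (intro sum.mono_neutral_right) (auto simp: W W'_def)
  also have "\<dots> = (\<Sum>r\<in>R ` W'. \<Sum>w\<in>{w\<in>W'. R w = r}. ?q w)"
    by (rule sum.image_gen[OF W'fin])
  also have "\<dots> \<le> (\<Sum>r\<in>R ` W'. C\<^sup>2 * (\<Sum>v\<in>(\<lambda>t. \<kappa> t @ r) ` Vr r. ?g v))"
    by (intro sum_mono fibre)
  \<comment> \<open>By uniqueness of the factorization, different remainders use disjoint sets of
    input words, so the fibre bounds add up without loss.\<close>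
  also have "\<dots> = C\<^sup>2 * (\<Sum>v\<in>(\<Union>r\<in>R ` W'. (\<lambda>t. \<kappa> t @ r) ` Vr r). ?g v)"
  proof (subst sum.UNION_disjoint)
    show "\<forall>r\<in>R ` W'. \<forall>r'\<in>R ` W'. r \<noteq> r' \<longrightarrow> (\<lambda>t. \<kappa> t @ r) ` Vr r \<inter> (\<lambda>t. \<kappa> t @ r') ` Vr r' = {}"
      using T.rigid_unique dec(3) by (fastforce simp: Vr_def)
  qed (use W'fin finVr in \<open>auto simp: sum_distrib_left\<close>)
  also have "\<dots> \<le> C\<^sup>2 * (\<Sum>v\<in>V. ?g v)"
    using V by (intro mult_left_mono sum_mono2) (auto simp: Vr_def intro: sum_nonneg)
  finally show "(\<Sum>w\<in>W. ?q w) \<le> C\<^sup>2 * (\<Sum>v\<in>V. ?g v)" .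
qed

section \<open>The space of square-summable functions\<close>

lemma conv_add: "conv (\<lambda>w. f w + f' w) g w = conv f g w + conv f' g w"
  by (simp add: conv_def case_prod_unfold sum.distrib distrib_right)

lemma conv_scale: "conv (\<lambda>w. a * f w) g w = a * conv f g w"
  by (simp add: conv_def case_prod_unfold sum_distrib_left mult.assoc)

lemma conv_diff: "conv (\<lambda>w. f w - f' w) g w = conv f g w - conv f' g w"
  by (simp add: conv_def case_prod_unfold sum_subtractf left_diff_distrib)

lemma conv_add_right: "conv f (\<lambda>w. g w + g' w) w = conv f g w + conv f g' w"
  by (simp add: conv_def case_prod_unfold sum.distrib distrib_left)

lemma conv_scale_right: "conv f (\<lambda>w. a * g w) w = a * conv f g w"
  by (simp add: conv_def case_prod_unfold sum_distrib_left mult_ac)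

lemma conv_sum_right: "conv f (\<lambda>w. \<Sum>x\<in>X. g x w) w = (\<Sum>x\<in>X. conv f (g x) w)"
  by (simp add: conv_def case_prod_unfold sum_distrib_left sum.swap[of _ X])

text \<open>The basis vector of the empty word. Evaluating an operator here yields its coefficient
  function.\<close>

definition vac :: "nat list \<Rightarrow> complex" where
  "vac w = (if w = [] then 1 else 0)"

lemma conv_vac: "conv f vac w = f w"
proof -
  have "conv f vac w = (\<Sum>(u, v)\<in>{(w, [])}. f u * vac v)"
    unfolding conv_def
    by (rule sum.mono_neutral_right[OF finite_splits]) (auto simp: splits_def vac_def split: if_splits)
  then show ?thesis by (simp add: vac_def)
qed

lemma conv_single: "conv f (\<lambda>w. if w = v then c else 0) (u @ v) = f u * c"
proof -
  have "conv f (\<lambda>w. if w = v then c else 0) (u @ v)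
      = (\<Sum>(u, x)\<in>{(u, v)}. f u * (if x = v then c else 0))"
    unfolding conv_def
    by (rule sum.mono_neutral_right[OF finite_splits]) (auto simp: splits_def split: if_splits)
  then show ?thesis by simp
qed

lemma conv_single0: "(\<And>u. w \<noteq> u @ v) \<Longrightarrow> conv f (\<lambda>w. if w = v then c else 0) w = 0"
  unfolding conv_def by (rule sum.neutral) (auto simp: splits_def)

lemma l2_supp: "f \<in> l2 K \<Longrightarrow> w \<notin> words K \<Longrightarrow> f w = 0"
  by (simp add: l2_def)

lemma nrm_nonneg: "0 \<le> nrm f"
  by (simp add: nrm_def infsum_nonneg)

lemma nrm_sq: "(nrm f)\<^sup>2 = infsum (\<lambda>w. (cmod (f w))\<^sup>2) UNIV"
  by (simp add: nrm_def infsum_nonneg)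

lemma sum_le_nrm:
  assumes "f \<in> l2 K" "finite W"
  shows "(\<Sum>w\<in>W. (cmod (f w))\<^sup>2) \<le> (nrm f)\<^sup>2"
  unfolding nrm_sq by (rule finite_sum_le_infsum) (use assms in \<open>auto simp: l2_def\<close>)

lemma bounded_sums:
  fixes q :: "'a \<Rightarrow> real"
  assumes "\<And>w. 0 \<le> q w" "\<And>W. finite W \<Longrightarrow> sum q W \<le> B"
  shows "q summable_on UNIV" "infsum q UNIV \<le> B"
proof -
  show "q summable_on UNIV"
    by (rule nonneg_bdd_above_summable_on) (use assms in \<open>auto intro!: bdd_aboveI\<close>)
  then show "infsum q UNIV \<le> B"
    by (rule infsum_le_finite_sums) (use assms in auto)
qed

text \<open>The way back from finite estimates such as \<open>mbound\<close> to membership and norm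
  in \<open>l2\<close>.\<close>

lemma l2I:
  assumes "\<And>w. w \<notin> words K \<Longrightarrow> f w = 0" "0 \<le> B"
    "\<And>W. finite W \<Longrightarrow> (\<Sum>w\<in>W. (cmod (f w))\<^sup>2) \<le> B\<^sup>2"
  shows "f \<in> l2 K" "nrm f \<le> B"
proof -
  note * = bounded_sums[of "\<lambda>w. (cmod (f w))\<^sup>2" "B\<^sup>2", OF _ assms(3)]
  show "f \<in> l2 K" using * assms(1) by (simp add: l2_def)
  have "(nrm f)\<^sup>2 \<le> B\<^sup>2" using * by (simp add: nrm_sq)
  then show "nrm f \<le> B" using assms(2) power2_le_imp_le by blast
qed

lemma cmod_le_nrm: "f \<in> l2 K \<Longrightarrow> cmod (f w) \<le> nrm f"
  using sum_le_nrm[of f K "{w}"] power2_le_imp_le nrm_nonneg by simp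

lemma l2_scale: "f \<in> l2 K \<Longrightarrow> (\<lambda>w. a * f w) \<in> l2 K"
  and nrm_scale: "nrm (\<lambda>w. a * f w) = cmod a * nrm f"
  by (auto simp: l2_def nrm_def norm_mult power_mult_distrib infsum_cmult_right' real_sqrt_mult
      intro: summable_on_cmult_right)

lemma
  assumes f: "f \<in> l2 K" and g: "g \<in> l2 K"
  shows l2_add: "(\<lambda>w. f w + g w) \<in> l2 K" and nrm_add: "nrm (\<lambda>w. f w + g w) \<le> nrm f + nrm g"
proof -
  have B: "(\<Sum>w\<in>W. (cmod (f w + g w))\<^sup>2) \<le> (nrm f + nrm g)\<^sup>2" if "finite W" for W
  proof -
    have "L2_set (\<lambda>w. cmod (f w + g w)) W \<le> L2_set (\<lambda>w. cmod (f w) + cmod (g w)) W"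
      by (rule L2_set_mono) (auto intro: norm_triangle_ineq)
    also have "\<dots> \<le> L2_set (\<lambda>w. cmod (f w)) W + L2_set (\<lambda>w. cmod (g w)) W"
      by (rule L2_set_triangle_ineq)
    also have "\<dots> \<le> nrm f + nrm g"
      using sum_le_nrm[OF f that] sum_le_nrm[OF g that] unfolding L2_set_def
      by (intro add_mono real_le_lsqrt) (auto simp: nrm_nonneg sum_nonneg)
    finally have "sqrt (\<Sum>w\<in>W. (cmod (f w + g w))\<^sup>2) \<le> nrm f + nrm g"
      by (simp add: L2_set_def)
    then show ?thesis by (rule sqrt_le_D)
  qed
  note * = l2I[of K "\<lambda>w. f w + g w" "nrm f + nrm g", OF _ _ B]
  show "(\<lambda>w. f w + g w) \<in> l2 K" "nrm (\<lambda>w. f w + g w) \<le> nrm f + nrm g"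
    using * f g by (simp_all add: l2_supp nrm_nonneg)
qed

lemma l2_0: "(\<lambda>_. 0) \<in> l2 K" and nrm_0: "nrm (\<lambda>_. 0) = 0"
  by (auto simp: l2_def nrm_def)

lemma
  assumes "finite X" "\<And>x. x \<in> X \<Longrightarrow> f x \<in> l2 K"
  shows l2_sum: "(\<lambda>w. \<Sum>x\<in>X. f x w) \<in> l2 K"
    and nrm_sum: "nrm (\<lambda>w. \<Sum>x\<in>X. f x w) \<le> (\<Sum>x\<in>X. nrm (f x))"
proof -
  have "(\<lambda>w. \<Sum>x\<in>X. f x w) \<in> l2 K \<and> nrm (\<lambda>w. \<Sum>x\<in>X. f x w) \<le> (\<Sum>x\<in>X. nrm (f x))"
    using assms
  proof (induction X rule: finite_induct)
    case (insert x X)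
    then have "(\<lambda>w. \<Sum>x\<in>X. f x w) \<in> l2 K" "f x \<in> l2 K"
      "nrm (\<lambda>w. \<Sum>x\<in>X. f x w) \<le> (\<Sum>x\<in>X. nrm (f x))" by auto
    then show ?case
      using insert.hyps l2_add[of "f x" K "\<lambda>w. \<Sum>x\<in>X. f x w"] nrm_add[of "f x" K "\<lambda>w. \<Sum>x\<in>X. f x w"]
      by simp
  qed (simp add: l2_0 nrm_0)
  then show "(\<lambda>w. \<Sum>x\<in>X. f x w) \<in> l2 K" "nrm (\<lambda>w. \<Sum>x\<in>X. f x w) \<le> (\<Sum>x\<in>X. nrm (f x))"
    by auto
qed

lemma l2_diff: "f \<in> l2 K \<Longrightarrow> g \<in> l2 K \<Longrightarrow> (\<lambda>w. f w - g w) \<in> l2 K"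
  using l2_add[of f K "\<lambda>w. - 1 * g w"] l2_scale[of g K "- 1"] by simp

lemma finite_support:
  assumes "finite V" "V \<subseteq> words K" "\<And>w. w \<notin> V \<Longrightarrow> f w = 0"
  shows finite_support_l2: "f \<in> l2 K"
    and finite_support_nrm: "(nrm f)\<^sup>2 = (\<Sum>w\<in>V. (cmod (f w))\<^sup>2)"
proof -
  have "((\<lambda>w. (cmod (f w))\<^sup>2) has_sum (\<Sum>w\<in>V. (cmod (f w))\<^sup>2)) UNIV"
    by (rule has_sum_finite_neutralI[where B = V]) (use assms in auto)
  then show "f \<in> l2 K" "(nrm f)\<^sup>2 = (\<Sum>w\<in>V. (cmod (f w))\<^sup>2)"
    using assms(2,3) by (auto simp: l2_def nrm_sq has_sum_iff)
qed

lemma vac_l2: "vac \<in> l2 K"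
  by (rule finite_support_l2[of "{[]}"]) (auto simp: vac_def)

lemma l2_tail:
  assumes f: "f \<in> l2 K" and "0 < e"
  shows "\<exists>V. finite V \<and> V \<subseteq> words K \<and> (\<forall>W. finite W \<longrightarrow> W \<inter> V = {} \<longrightarrow> (\<Sum>w\<in>W. (cmod (f w))\<^sup>2) \<le> e)"
proof -
  have s: "(\<lambda>w. (cmod (f w))\<^sup>2) summable_on UNIV" using f by (simp add: l2_def)
  from infsum_finite_approximation[OF this \<open>0 < e\<close>] obtain V where V: "finite V"
    "dist (\<Sum>w\<in>V. (cmod (f w))\<^sup>2) (infsum (\<lambda>w. (cmod (f w))\<^sup>2) UNIV) \<le> e" by blast
  have "(\<Sum>w\<in>W. (cmod (f w))\<^sup>2) \<le> e" if W: "finite W" "W \<inter> (V \<inter> words K) = {}" for W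
  proof -
    \<comment> \<open>Points of \<open>W\<close> inside \<open>V\<close> lie outside
      \<open>words K\<close>, where \<open>f\<close> vanishes.\<close>
    have "(\<Sum>w\<in>W. (cmod (f w))\<^sup>2) = (\<Sum>w\<in>W - V. (cmod (f w))\<^sup>2)"
      using W l2_supp[OF f] by (intro sum.mono_neutral_right) auto
    also have "(\<Sum>w\<in>W - V. (cmod (f w))\<^sup>2) + (\<Sum>w\<in>V. (cmod (f w))\<^sup>2) = (\<Sum>w\<in>(W - V) \<union> V. (cmod (f w))\<^sup>2)"
      using W V(1) by (intro sum.union_disjoint[symmetric]) auto
    then have "(\<Sum>w\<in>W - V. (cmod (f w))\<^sup>2) + (\<Sum>w\<in>V. (cmod (f w))\<^sup>2) \<le> infsum (\<lambda>w. (cmod (f w))\<^sup>2) UNIV"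
      using finite_sum_le_infsum[OF s, of "(W - V) \<union> V"] W V(1) by simp
    then have "(\<Sum>w\<in>W - V. (cmod (f w))\<^sup>2) \<le> e"
      using V(2) by (simp add: dist_real_def)
    finally show ?thesis .
  qed
  then show ?thesis using V(1) by (intro exI[of _ "V \<inter> words K"]) auto
qed

text \<open>Dominated convergence: off a finite set the tail of \<open>f\<close> controls every
  \<open>h N\<close>, and on the finite set pointwise convergence suffices.\<close>

lemma nrm_dominated_tendsto:
  assumes f: "f \<in> l2 K" and dom: "\<And>N w. cmod (h N w) \<le> cmod (f w)"
    and lim: "\<And>w. (\<lambda>N. h N w) \<longlonglongrightarrow> 0"
  shows "h N \<in> l2 K" "(\<lambda>N. nrm (h N)) \<longlonglongrightarrow> 0"
proof -
  have dom2: "(cmod (h N w))\<^sup>2 \<le> (cmod (f w))\<^sup>2" for N w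
    using dom by (simp add: power_mono)
  have supp: "h N w = 0" if "w \<notin> words K" for N w
    using dom[of N w] l2_supp[OF f that] by simp
  show "h N \<in> l2 K" for N
    by (rule l2I[of _ _ "nrm f"]) (auto simp: supp nrm_nonneg intro!: order_trans[OF sum_mono[OF dom2] sum_le_nrm[OF f]])
  show "(\<lambda>N. nrm (h N)) \<longlonglongrightarrow> 0"
  proof (rule LIMSEQ_I)
    fix e :: real assume e: "0 < e"
    obtain V where V: "finite V" "\<And>W. finite W \<Longrightarrow> W \<inter> V = {} \<Longrightarrow> (\<Sum>w\<in>W. (cmod (f w))\<^sup>2) \<le> e\<^sup>2 / 4"
      using l2_tail[OF f, of "e\<^sup>2 / 4"] e by auto
    have "(\<lambda>N. \<Sum>w\<in>V. (cmod (h N w))\<^sup>2) \<longlonglongrightarrow> (\<Sum>w\<in>V. (cmod 0)\<^sup>2)"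
      by (intro tendsto_intros lim)
    then have "\<forall>\<^sub>F N in sequentially. (\<Sum>w\<in>V. (cmod (h N w))\<^sup>2) < e\<^sup>2 / 4"
      using e by (intro order_tendstoD) auto
    then obtain N0 where N0: "\<And>N. N \<ge> N0 \<Longrightarrow> (\<Sum>w\<in>V. (cmod (h N w))\<^sup>2) < e\<^sup>2 / 4"
      by (auto simp: eventually_sequentially)
    have "nrm (h N) < e" if "N \<ge> N0" for N
    proof -
      \<comment> \<open>Two contributions of \<open>e\<^sup>2 / 4\<close> stay below the square of
        \<open>e * 3 / 4\<close>, which leaves room for the strict inequality.\<close>
      have "nrm (h N) \<le> e * 3 / 4"
      proof (rule l2I)
        fix W :: "nat list set" assume W: "finite W"
        have "(\<Sum>w\<in>W. (cmod (h N w))\<^sup>2) \<le> (\<Sum>w\<in>V \<union> (W - V). (cmod (h N w))\<^sup>2)"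
          using W V(1) by (intro sum_mono2) auto
        also have "\<dots> = (\<Sum>w\<in>V. (cmod (h N w))\<^sup>2) + (\<Sum>w\<in>W - V. (cmod (h N w))\<^sup>2)"
          using W V(1) by (intro sum.union_disjoint) auto
        also have "\<dots> \<le> e\<^sup>2 / 4 + (\<Sum>w\<in>W - V. (cmod (f w))\<^sup>2)"
          using N0[OF that] by (intro add_mono sum_mono dom2) auto
        also have "\<dots> \<le> e\<^sup>2 / 4 + e\<^sup>2 / 4"
          using V(2)[of "W - V"] W by (simp add: Int_Diff Diff_Int_distrib2 Int_commute)
        also have "\<dots> \<le> (e * 3 / 4)\<^sup>2" by (simp add: power2_eq_square field_simps)
        finally show "(\<Sum>w\<in>W. (cmod (h N w))\<^sup>2) \<le> (e * 3 / 4)\<^sup>2" .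
      qed (use e supp in auto)
      then show ?thesis using e by simp
    qed
    then show "\<exists>no. \<forall>n\<ge>no. norm (nrm (h n) - 0) < e"
      using nrm_nonneg by (auto intro!: exI[of _ N0])
  qed
qed

section \<open>Sums of multiplier bounds, and multipliers as operators on \<open>l2\<close>\<close>

lemma mbound_nonneg: "mbound K n F C \<Longrightarrow> 0 \<le> C"
  by (simp add: mbound_def)

text \<open>Minkowski's inequality for the family indexed by pairs of an output word and a
  row.\<close>

lemma mbound_add:
  assumes "mbound K n F C" "mbound K n F' C'"
  shows "mbound K n (\<lambda>i j w. F i j w + F' i j w) (C + C')"
  unfolding mbound_def
proof (intro conjI allI impI)
  show "0 \<le> C + C'" using assms by (simp add: mbound_def)
next
  fix G :: "nat \<Rightarrow> nat list \<Rightarrow> complex" and V W :: "nat list set"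
  assume V: "finite V" and W: "finite W" and "V \<subseteq> words K" and "\<forall>j v. v \<notin> V \<longrightarrow> G j v = 0"
  then have b: "(\<Sum>w\<in>W. \<Sum>i<n. (cmod (\<Sum>j<n. conv (F i j) (G j) w))\<^sup>2) \<le> C\<^sup>2 * (\<Sum>v\<in>V. \<Sum>j<n. (cmod (G j v))\<^sup>2)"
    "(\<Sum>w\<in>W. \<Sum>i<n. (cmod (\<Sum>j<n. conv (F' i j) (G j) w))\<^sup>2) \<le> C'\<^sup>2 * (\<Sum>v\<in>V. \<Sum>j<n. (cmod (G j v))\<^sup>2)"
    using assms by (auto intro!: mboundD)
  define s where "s = (\<Sum>v\<in>V. \<Sum>j<n. (cmod (G j v))\<^sup>2)"
  have s: "0 \<le> s" by (simp add: s_def sum_nonneg)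
  have C: "0 \<le> C" "0 \<le> C'" using assms by (auto simp: mbound_def)
  define a where "a = (\<lambda>(w, i). cmod (\<Sum>j<n. conv (F i j) (G j) w))"
  define a' where "a' = (\<lambda>(w, i). cmod (\<Sum>j<n. conv (F' i j) (G j) w))"
  have "L2_set (\<lambda>(w, i). cmod (\<Sum>j<n. conv (\<lambda>w. F i j w + F' i j w) (G j) w)) (W \<times> {..<n})
      \<le> L2_set (\<lambda>x. a x + a' x) (W \<times> {..<n})"
    by (rule L2_set_mono) (auto simp: conv_add sum.distrib a_def a'_def intro: norm_triangle_ineq)
  also have "\<dots> \<le> L2_set a (W \<times> {..<n}) + L2_set a' (W \<times> {..<n})"
    by (rule L2_set_triangle_ineq)
  also have "L2_set a (W \<times> {..<n}) \<le> sqrt (C\<^sup>2 * s)"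
    using b(1) by (simp add: L2_set_def a_def s_def sum.cartesian_product case_prod_unfold)
  also have "L2_set a' (W \<times> {..<n}) \<le> sqrt (C'\<^sup>2 * s)"
    using b(2) by (simp add: L2_set_def a'_def s_def sum.cartesian_product case_prod_unfold)
  also have "sqrt (C\<^sup>2 * s) + sqrt (C'\<^sup>2 * s) = (C + C') * sqrt s"
    using C by (simp add: real_sqrt_mult algebra_simps)
  finally have "sqrt (\<Sum>w\<in>W. \<Sum>i<n. (cmod (\<Sum>j<n. conv (\<lambda>w. F i j w + F' i j w) (G j) w))\<^sup>2) \<le> (C + C') * sqrt s"
    by (simp add: L2_set_def sum.cartesian_product case_prod_unfold)
  then have "(\<Sum>w\<in>W. \<Sum>i<n. (cmod (\<Sum>j<n. conv (\<lambda>w. F i j w + F' i j w) (G j) w))\<^sup>2) \<le> ((C + C') * sqrt s)\<^sup>2"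
    by (rule sqrt_le_D)
  then show "(\<Sum>w\<in>W. \<Sum>i<n. (cmod (\<Sum>j<n. conv (\<lambda>w. F i j w + F' i j w) (G j) w))\<^sup>2)
      \<le> (C + C')\<^sup>2 * (\<Sum>v\<in>V. \<Sum>j<n. (cmod (G j v))\<^sup>2)"
    using s by (simp add: power_mult_distrib s_def)
qed

lemma mbound_uminus:
  assumes "mbound K n F C"
  shows "mbound K n (\<lambda>i j w. - F i j w) C"
proof -
  have "conv (\<lambda>w. - F i j w) g w = - conv (F i j) g w" for i j g w
    using conv_scale[of "- 1" "F i j" g w] by simp
  then show ?thesis
    using assms by (simp add: mbound_def sum_negf)
qed

lemma mbound_diff:
  "mbound K n F C \<Longrightarrow> mbound K n F' C' \<Longrightarrow> mbound K n (\<lambda>i j w. F i j w - F' i j w) (C + C')"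
  using mbound_add[OF _ mbound_uminus] by fastforce

lemma conv_supp:
  assumes "\<And>w. w \<notin> words K \<Longrightarrow> f w = 0" "\<And>w. w \<notin> words K \<Longrightarrow> g w = 0" "w \<notin> words K"
  shows "conv f g w = 0"
  unfolding conv_def
proof (rule sum.neutral, clarify)
  fix u v assume "(u, v) \<in> splits w"
  then have "u \<notin> words K \<or> v \<notin> words K" using assms(3) by (auto simp: splits_def)
  then show "f u * g v = 0" using assms(1,2) by auto
qed

text \<open>Finitely many output words see only their finitely many suffixes as input, so each
  \<open>g j\<close> may be cut down to a finitely supported vector without changing these
  outputs.\<close>

lemma mbound_l2:
  assumes bd: "mbound K n F C" and g: "\<And>j. j < n \<Longrightarrow> g j \<in> l2 K" and W: "finite W"
  shows "(\<Sum>w\<in>W. \<Sum>i<n. (cmod (\<Sum>j<n. conv (F i j) (g j) w))\<^sup>2) \<le> C\<^sup>2 * (\<Sum>j<n. (nrm (g j))\<^sup>2)"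
proof -
  define V where "V = (\<Union>w\<in>W. snd ` splits w) \<inter> words K"
  define G where "G j v = (if v \<in> V then g j v else 0)" for j v
  have V: "finite V" using W by (auto simp: V_def)
  have "conv (F i j) (g j) w = conv (F i j) (G j) w" if "w \<in> W" "j < n" for i j w
    unfolding conv_def
  proof (rule sum.cong, simp, clarify)
    fix u v assume "(u, v) \<in> splits w"
    then have "v \<in> (\<Union>w\<in>W. snd ` splits w)" using that(1) by force
    then have "g j v = G j v" using l2_supp[OF g[OF that(2)]] by (auto simp: G_def V_def)
    then show "F i j u * g j v = F i j u * G j v" by simp
  qed
  then have "(\<Sum>w\<in>W. \<Sum>i<n. (cmod (\<Sum>j<n. conv (F i j) (g j) w))\<^sup>2)
      = (\<Sum>w\<in>W. \<Sum>i<n. (cmod (\<Sum>j<n. conv (F i j) (G j) w))\<^sup>2)"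
    by simp
  also have "\<dots> \<le> C\<^sup>2 * (\<Sum>v\<in>V. \<Sum>j<n. (cmod (G j v))\<^sup>2)"
    by (rule mboundD[OF bd V W]) (auto simp: G_def V_def)
  also have "(\<Sum>v\<in>V. \<Sum>j<n. (cmod (G j v))\<^sup>2) = (\<Sum>j<n. \<Sum>v\<in>V. (cmod (G j v))\<^sup>2)"
    by (rule sum.swap)
  also have "\<dots> \<le> (\<Sum>j<n. (nrm (g j))\<^sup>2)"
    using sum_le_nrm[OF g V] by (intro sum_mono) (simp add: G_def)
  finally show ?thesis by (simp add: mult_left_mono)
qed

text \<open>The value off \<open>l2\<close> is the one that \<open>is_op\<close> prescribes, so that
  operators can be compared by plain equality.\<close>

definition mult :: "enat \<Rightarrow> (nat list \<Rightarrow> complex) \<Rightarrow> op" where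
  "mult K f g = (if g \<in> l2 K then conv f g else (\<lambda>_. 0))"

abbreviation mbound1 :: "enat \<Rightarrow> (nat list \<Rightarrow> complex) \<Rightarrow> real \<Rightarrow> bool" where
  "mbound1 K f C \<equiv> mbound K 1 (\<lambda>_ _. f) C"

lemma mbound1_conv:
  assumes "mbound1 K f C" "\<And>w. w \<notin> words K \<Longrightarrow> f w = 0" "g \<in> l2 K"
  shows "conv f g \<in> l2 K" "nrm (conv f g) \<le> C * nrm g"
proof -
  have "(\<Sum>w\<in>W. (cmod (conv f g w))\<^sup>2) \<le> (C * nrm g)\<^sup>2" if "finite W" for W
    using mbound_l2[OF assms(1) _ that, of "\<lambda>_. g"] assms(3) by (simp add: power_mult_distrib)
  note * = l2I[of K "conv f g" "C * nrm g", OF _ _ this]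
  have "conv f g w = 0" if "w \<notin> words K" for w
    by (rule conv_supp[OF _ _ that]) (use assms(2) l2_supp[OF assms(3)] in auto)
  then show "conv f g \<in> l2 K" "nrm (conv f g) \<le> C * nrm g"
    using * mbound_nonneg[OF assms(1)] nrm_nonneg by simp_all
qed

lemma mult_is_op:
  assumes "mbound1 K f C" "\<And>w. w \<notin> words K \<Longrightarrow> f w = 0"
  shows "is_op K (mult K f)"
  unfolding is_op_def
proof (intro conjI ballI allI)
  fix g h a b assume "g \<in> l2 K" "h \<in> l2 K"
  then show "mult K f (\<lambda>w. a * g w + b * h w) = (\<lambda>w. a * mult K f g w + b * mult K f h w)"
    by (simp add: mult_def l2_add l2_scale fun_eq_iff conv_add_right conv_scale_right)
qed (use mbound1_conv[OF assms] in \<open>auto simp: mult_def\<close>)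

section \<open>Coefficients of operators in the algebra\<close>

text \<open>The Fejer weight \<open>N - length u\<close> counts the windows of \<open>N\<close> consecutive degrees that contain the
  degrees of both \<open>v\<close> and \<open>u @ v\<close>; hence the weighted multiplier is an average of compressions.\<close>

lemma mbound_fejer:
  assumes bd: "mbound K n F C" and N: "0 < N"
  shows "mbound K n (\<lambda>i j w. of_nat (N - length w) / of_nat N * F i j w) C"
  unfolding mbound_def
proof (intro conjI allI impI)
  show "0 \<le> C" using bd by (rule mbound_nonneg)
next
  fix G :: "nat \<Rightarrow> nat list \<Rightarrow> complex" and V W :: "nat list set"
  assume V: "finite V" and W: "finite W" and VK: "V \<subseteq> words K" and G0: "\<forall>j v. v \<notin> V \<longrightarrow> G j v = 0"
  \<comment> \<open>\<open>Q r\<close> keeps the part of \<open>G\<close> in the window of degrees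
    from \<open>r - N\<close> to \<open>r - 1\<close>.\<close>
  define Q where "Q r j v = (if r \<in> {length v<..length v + N} then G j v else 0)" for r j v
  define a where "a r w = (\<Sum>i<n. (cmod (\<Sum>j<n. conv (F i j) (Q r j) w))\<^sup>2)" for r w
  let ?F = "\<lambda>i j w. of_nat (N - length w) / of_nat N * F i j w"
  let ?g = "\<lambda>v. \<Sum>j<n. (cmod (G j v))\<^sup>2"
  have avg: "conv (?F i j) (G j) w = (\<Sum>r\<in>{length w<..length w + N}. conv (F i j) (Q r j) w) / of_nat N" for i j w
  proof -
    have "(\<Sum>r\<in>{length w<..length w + N}. conv (F i j) (Q r j) w)
        = (\<Sum>(u, v)\<in>splits w. \<Sum>r\<in>{length w<..length w + N}. F i j u * Q r j v)"
      by (simp add: conv_def case_prod_unfold sum.swap[of _ "splits w"])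
    also have "\<dots> = (\<Sum>(u, v)\<in>splits w. of_nat (N - length u) * (F i j u * G j v))"
    proof (rule sum.cong, simp, clarify)
      fix u v assume "(u, v) \<in> splits w"
      then have w: "length w = length u + length v" by (auto simp: splits_def)
      \<comment> \<open>The common windows of \<open>w\<close> and \<open>v\<close> number
        \<open>N - length u\<close>; truncated subtraction gives 0 once \<open>u\<close> has length
        at least \<open>N\<close>.\<close>
      have "{length w<..length w + N} \<inter> {r. r \<in> {length v<..length v + N}} = {length w<..length v + N}"
        using w by auto
      then show "(\<Sum>r\<in>{length w<..length w + N}. F i j u * Q r j v) = of_nat (N - length u) * (F i j u * G j v)"
        using w by (simp add: Q_def if_distrib[of "\<lambda>x. F i j u * x"] sum.If_cases del: greaterThanAtMost_iff cong: if_cong)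
    qed
    also have "\<dots> = of_nat N * conv (?F i j) (G j) w"
      using N by (simp add: conv_def case_prod_unfold sum_distrib_left mult.assoc)
    finally show ?thesis using N by simp
  qed
  \<comment> \<open>Cauchy-Schwarz over \<open>N\<close> windows costs a factor \<open>N\<close>,
    which cancels one of the two powers of \<open>N\<close> in the squared average.\<close>
  have cs: "(cmod (\<Sum>j<n. conv (?F i j) (G j) w))\<^sup>2
      \<le> (\<Sum>r\<in>{length w<..length w + N}. (cmod (\<Sum>j<n. conv (F i j) (Q r j) w))\<^sup>2) / N" for i w
  proof -
    let ?R = "{length w<..length w + N}"
    let ?c = "\<lambda>r. \<Sum>j<n. conv (F i j) (Q r j) w"
    have "(\<Sum>j<n. conv (?F i j) (G j) w) = (\<Sum>r\<in>?R. ?c r) / of_nat N"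
      by (simp only: avg sum_divide_distrib[symmetric] sum.swap[of _ ?R "{..<n}"])
    then have "(cmod (\<Sum>j<n. conv (?F i j) (G j) w))\<^sup>2 = (cmod (\<Sum>r\<in>?R. ?c r))\<^sup>2 / (real N)\<^sup>2"
      by (simp add: norm_divide power_divide)
    also have "(cmod (\<Sum>r\<in>?R. ?c r))\<^sup>2 \<le> (\<Sum>r\<in>?R. cmod (?c r))\<^sup>2"
      by (intro power_mono norm_sum) simp
    also have "\<dots> \<le> real N * (\<Sum>r\<in>?R. (cmod (?c r))\<^sup>2)"
      using Cauchy_Schwarz_ineq_sum[of "\<lambda>_. 1" "\<lambda>r. cmod (?c r)" ?R] by simp
    finally show ?thesis
      using N by (simp add: divide_right_mono power2_eq_square)
  qed
  define M where "M = Suc (Max (length ` (V \<union> W \<union> {[]}))) + N"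
  have le: "{length w<..length w + N} \<subseteq> {..M}" if "w \<in> V \<union> W" for w
  proof -
    have "length w \<le> Max (length ` (V \<union> W \<union> {[]}))"
      using that V W by (intro Max_ge) auto
    then show ?thesis by (auto simp: M_def)
  qed
  have "(\<Sum>w\<in>W. \<Sum>i<n. (cmod (\<Sum>j<n. conv (?F i j) (G j) w))\<^sup>2)
      \<le> (\<Sum>w\<in>W. \<Sum>i<n. (\<Sum>r\<in>{length w<..length w + N}. (cmod (\<Sum>j<n. conv (F i j) (Q r j) w))\<^sup>2) / N)"
    by (intro sum_mono cs)
  also have "\<dots> = (\<Sum>w\<in>W. \<Sum>r\<in>{length w<..length w + N}. a r w) / N"
    by (simp add: a_def sum_divide_distrib[symmetric] sum.swap[of _ "{..<n}"])
  also have "\<dots> \<le> (\<Sum>w\<in>W. \<Sum>r\<in>{..M}. a r w) / N"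
    by (intro divide_right_mono sum_mono sum_mono2 le) (auto simp: a_def sum_nonneg)
  also have "(\<Sum>w\<in>W. \<Sum>r\<in>{..M}. a r w) = (\<Sum>r\<in>{..M}. \<Sum>w\<in>W. a r w)"
    by (rule sum.swap)
  also have "\<dots> \<le> (\<Sum>r\<in>{..M}. C\<^sup>2 * (\<Sum>v\<in>V. \<Sum>j<n. (cmod (Q r j v))\<^sup>2))"
    unfolding a_def using G0 by (intro sum_mono mboundD[OF bd V W VK]) (simp add: Q_def)
  also have "\<dots> = C\<^sup>2 * (\<Sum>v\<in>V. \<Sum>r\<in>{..M}. \<Sum>j<n. (cmod (Q r j v))\<^sup>2)"
    by (simp add: sum_distrib_left[symmetric] sum.swap[of _ V])
  \<comment> \<open>Each input word lies in exactly \<open>N\<close> windows; this cancels the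
    remaining division by \<open>N\<close>.\<close>
  also have "(\<Sum>v\<in>V. \<Sum>r\<in>{..M}. \<Sum>j<n. (cmod (Q r j v))\<^sup>2) = (\<Sum>v\<in>V. \<Sum>r\<in>{length v<..length v + N}. ?g v)"
  proof (rule sum.cong)
    fix v assume v: "v \<in> V"
    show "(\<Sum>r\<in>{..M}. \<Sum>j<n. (cmod (Q r j v))\<^sup>2) = (\<Sum>r\<in>{length v<..length v + N}. ?g v)"
      using le[of v] v by (intro sum.mono_neutral_cong_right) (auto simp: Q_def)
  qed simp
  also have "\<dots> = N * (\<Sum>v\<in>V. ?g v)"
    by (simp add: sum_distrib_left)
  finally show "(\<Sum>w\<in>W. \<Sum>i<n. (cmod (\<Sum>j<n. conv (?F i j) (G j) w))\<^sup>2) \<le> C\<^sup>2 * (\<Sum>v\<in>V. ?g v)"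
    using N by (simp add: divide_right_mono)
qed

section \<open>Fejer truncation and strong approximation\<close>

lemma code_block_id:
  "code_block A (\<lambda>s. s) {0} (\<lambda>_. c)" if "c = []"
  using that by unfold_locales auto

text \<open>Letters are cut off at \<open>N\<close> as well as degrees: over an infinite alphabet a
  bound on the length alone would not give finite support.\<close>

definition fejer :: "enat \<Rightarrow> nat \<Rightarrow> (nat list \<Rightarrow> complex) \<Rightarrow> nat list \<Rightarrow> complex" where
  "fejer K N f w = (if w \<in> words (min K (enat N)) then of_nat (N - length w) / of_nat N * f w else 0)"

lemma words_min: "words (min K L) = words K \<inter> words L"
  by (auto simp: words_def)

text \<open>Restricting coefficients to a smaller alphabet is a transfer of the identity code on
  that alphabet to itself, so it does not increase the bound.\<close>

lemma mbound_fejer_truncated: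
  assumes "mbound1 K f C" "0 < N"
  shows "mbound1 K (fejer K N f) C"
  by (rule mbound_transfer[where A = "min K (enat N)",
        OF code_block_id[OF refl] code_block_id[OF refl] _ mbound_fejer[OF assms]])
    (auto simp: fejer_def words_min)

lemma fejer_finite: "finite {w. fejer K N f w \<noteq> 0}" "{w. fejer K N f w \<noteq> 0} \<subseteq> words K"
proof -
  have "{w. fejer K N f w \<noteq> 0} \<subseteq> {w. set w \<subseteq> {..<N} \<and> length w \<le> N}"
    by (auto simp: fejer_def words_def)
  then show "finite {w. fejer K N f w \<noteq> 0}"
    by (rule finite_subset) (rule finite_lists_length_le, simp)
  show "{w. fejer K N f w \<noteq> 0} \<subseteq> words K"
    by (auto simp: fejer_def words_min)
qed

lemma fejer_le: "cmod (f w - fejer K N f w) \<le> cmod (f w)"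
proof (cases "w \<in> words (min K (enat N)) \<and> N \<noteq> 0")
  case True
  have "f w - fejer K N f w = of_real (1 - (N - length w) / N) * f w"
    using True by (simp add: fejer_def algebra_simps)
  then have "cmod (f w - fejer K N f w) = \<bar>1 - (N - length w) / N\<bar> * cmod (f w)"
    by (simp only: norm_mult norm_of_real)
  also have "\<dots> \<le> 1 * cmod (f w)"
    using True by (intro mult_right_mono) (auto simp: field_simps abs_le_iff)
  finally show ?thesis by simp
qed (auto simp: fejer_def)

lemma fejer_tendsto:
  assumes "\<And>w. w \<notin> words K \<Longrightarrow> f w = 0"
  shows "(\<lambda>N. f w - fejer K N f w) \<longlonglongrightarrow> 0"
proof (cases "w \<in> words K")
  case True
  have "(\<lambda>N. of_real (length w / real N) * f w) \<longlonglongrightarrow> of_real 0 * f w"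
    by (intro tendsto_intros lim_const_over_n)
  moreover have "\<forall>\<^sub>F N in sequentially. of_real (length w / real N) * f w = f w - fejer K N f w"
  proof (rule eventually_sequentiallyI)
    \<comment> \<open>The extra \<open>0\<close> keeps \<open>Max\<close> defined for the empty
      word. Beyond this threshold all letters of \<open>w\<close> and its length are below
      \<open>N\<close>, so only the weight is left.\<close>
    fix N assume N: "N \<ge> Suc (Max (set (0 # w)) + length w)"
    have "a < N" if "a \<in> set w" for a
    proof -
      have "a \<le> Max (set (0 # w))" using that by (intro Max_ge) auto
      then show ?thesis using N by linarith
    qed
    then have "w \<in> words (min K (enat N))"
      using True by (auto simp: words_min words_def)
    then show "of_real (length w / real N) * f w = f w - fejer K N f w"
      using N by (simp add: fejer_def field_simps of_nat_diff)
  qed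
  ultimately show ?thesis by (simp add: tendsto_cong)
qed (simp add: fejer_def words_min assms)

text \<open>Convolution with a point mass at \<open>v\<close> is right translation by
  \<open>v\<close> up to a scalar, so domination and pointwise limits pass through it.\<close>

lemma tendsto_conv_single:
  assumes h: "h \<in> l2 K" and dom: "\<And>N w. cmod (hN N w) \<le> cmod (h w)" and lim: "\<And>w. (\<lambda>N. hN N w) \<longlonglongrightarrow> 0"
    and v: "conv h (\<lambda>w. if w = v then c else 0) \<in> l2 K"
  shows "(\<lambda>N. nrm (conv (hN N) (\<lambda>w. if w = v then c else 0))) \<longlonglongrightarrow> 0"
proof (rule nrm_dominated_tendsto[OF v])
  fix w
  have c: "(\<exists>u. w = u @ v) \<or> (\<forall>u. w \<noteq> u @ v)" by blast
  then show "cmod (conv (hN N) (\<lambda>w. if w = v then c else 0) w) \<le> cmod (conv h (\<lambda>w. if w = v then c else 0) w)" for N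
    by (auto simp: conv_single conv_single0 norm_mult intro!: mult_right_mono dom)
  have "(\<lambda>N. hN N u * c) \<longlonglongrightarrow> 0 * c" for u
    by (intro tendsto_intros lim)
  with c show "(\<lambda>N. conv (hN N) (\<lambda>w. if w = v then c else 0) w) \<longlonglongrightarrow> 0"
    by (auto simp: conv_single conv_single0)
qed

text \<open>Split \<open>g\<close> into finitely many point masses and a small tail. Dominated
  convergence handles the point masses; on the tail the bound \<open>C + C\<close>, uniform in
  \<open>N\<close>, is enough.\<close>

lemma fejer_strong:
  assumes bd: "mbound1 K f C" and supp: "\<And>w. w \<notin> words K \<Longrightarrow> f w = 0" and g: "g \<in> l2 K" and e: "0 < e"
  shows "\<forall>\<^sub>F N in sequentially. nrm (\<lambda>w. conv f g w - conv (fejer K N f) g w) < e"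
proof -
  define h where "h N w = f w - fejer K N f w" for N w
  have C: "0 \<le> C" using mbound_nonneg[OF bd] .
  have fl2: "f \<in> l2 K"
    using mbound1_conv(1)[OF bd supp vac_l2] by (simp add: conv_vac[abs_def])
  have hsupp: "h N w = 0" if "w \<notin> words K" for N w
    using that supp by (simp add: h_def fejer_def words_min)
  \<comment> \<open>Then \<open>(C + C) * d\<close> is at most \<open>e / 2\<close>; the summand 1
    avoids division by zero.\<close>
  define d where "d = e / (4 * (C + 1))"
  have d: "0 < d" using e C by (simp add: d_def)
  then obtain V where V: "finite V" "V \<subseteq> words K" "\<And>W. finite W \<Longrightarrow> W \<inter> V = {} \<Longrightarrow> (\<Sum>w\<in>W. (cmod (g w))\<^sup>2) \<le> d\<^sup>2"
    using l2_tail[OF g, of "d\<^sup>2"] by auto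
  define s where "s v w = (if w = v then g v else 0)" for v w :: "nat list"
  define t where "t w = (if w \<in> V then 0 else g w)" for w
  have t: "t \<in> l2 K" "nrm t \<le> d"
  proof -
    have "(\<Sum>w\<in>W. (cmod (t w))\<^sup>2) \<le> d\<^sup>2" if "finite W" for W
    proof -
      have "(\<Sum>w\<in>W. (cmod (t w))\<^sup>2) = (\<Sum>w\<in>W - V. (cmod (g w))\<^sup>2)"
        using that by (intro sum.mono_neutral_cong_right) (auto simp: t_def)
      then show ?thesis using V(3)[of "W - V"] that by auto
    qed
    note * = l2I[of K t d, OF _ _ this]
    show "t \<in> l2 K" "nrm t \<le> d" using * d l2_supp[OF g] by (auto simp: t_def)
  qed
  have g_eq: "g = (\<lambda>w. (\<Sum>v\<in>V. s v w) + t w)"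
    using V(1) by (auto simp: fun_eq_iff s_def t_def)
  have s: "s v \<in> l2 K" if "v \<in> V" for v
    using V(2) that by (intro finite_support_l2[of "{v}"]) (auto simp: s_def)
  have hb: "mbound1 K (h N) (C + C)" if "0 < N" for N
    using mbound_diff[OF bd mbound_fejer_truncated[OF bd that]] by (simp add: h_def[abs_def])
  have "(\<lambda>N. \<Sum>v\<in>V. nrm (conv (h N) (s v))) \<longlonglongrightarrow> (\<Sum>v\<in>V. 0)"
  proof (rule tendsto_sum)
    fix v assume v: "v \<in> V"
    show "(\<lambda>N. nrm (conv (h N) (s v))) \<longlonglongrightarrow> 0"
      unfolding s_def
    proof (rule tendsto_conv_single[OF fl2])
      show "conv f (\<lambda>w. if w = v then g v else 0) \<in> l2 K"
        using mbound1_conv(1)[OF bd supp s[OF v]] by (simp add: s_def[abs_def])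
      show "(\<lambda>N. h N w) \<longlonglongrightarrow> 0" for w
        unfolding h_def by (rule fejer_tendsto[OF supp])
    qed (simp add: h_def fejer_le)
  qed
  then have "\<forall>\<^sub>F N in sequentially. (\<Sum>v\<in>V. nrm (conv (h N) (s v))) < e / 4"
    using e by (intro order_tendstoD) auto
  with eventually_gt_at_top[of 0] show ?thesis
  proof eventually_elim
    case (elim N)
    have c: "conv (h N) (s v) \<in> l2 K" if "v \<in> V" for v
      using mbound1_conv(1)[OF hb hsupp s] elim that by blast
    have ct: "conv (h N) t \<in> l2 K" "nrm (conv (h N) t) \<le> (C + C) * nrm t"
      using mbound1_conv[OF hb hsupp t(1)] elim by blast+
    have "(\<lambda>w. conv f g w - conv (fejer K N f) g w) = conv (h N) g"
      by (simp add: fun_eq_iff h_def[abs_def] conv_diff)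
    also have "\<dots> = (\<lambda>w. (\<Sum>v\<in>V. conv (h N) (s v) w) + conv (h N) t w)"
      by (subst g_eq) (simp add: fun_eq_iff conv_add_right conv_sum_right)
    finally have "nrm (\<lambda>w. conv f g w - conv (fejer K N f) g w)
        = nrm (\<lambda>w. (\<Sum>v\<in>V. conv (h N) (s v) w) + conv (h N) t w)"
      by (rule arg_cong)
    also have "\<dots> \<le> nrm (\<lambda>w. \<Sum>v\<in>V. conv (h N) (s v) w) + nrm (conv (h N) t)"
      by (rule nrm_add[OF l2_sum[OF V(1)] ct(1)]) (rule c)
    also have "\<dots> \<le> (\<Sum>v\<in>V. nrm (conv (h N) (s v))) + (C + C) * nrm t"
      by (intro add_mono nrm_sum[where K = K, OF V(1)] ct c)
    also have "\<dots> < e / 4 + (C + C) * d"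
      using elim t(2) C by (intro add_less_le_mono mult_left_mono) auto
    also have "\<dots> \<le> e"
      using C e by (simp add: d_def field_simps)
    finally show ?case .
  qed
qed

section \<open>The algebra as the set of bounded left multipliers\<close>

lemma Lop_sum:
  assumes "finite X" "g \<in> l2 K"
  shows "(\<Sum>x\<in>X. c x * Lop K x g w) = conv (\<lambda>x. if x \<in> X then c x else 0) g w"
proof -
  have "conv (\<lambda>x. if x \<in> X then c x else 0) g w
      = (\<Sum>(u, v)\<in>(\<lambda>x. (x, drop (length x) w)) ` {x \<in> X. take (length x) w = x}. (if u \<in> X then c u else 0) * g v)"
    unfolding conv_def
  proof (rule sum.mono_neutral_right[OF finite_splits])
    show "(\<lambda>x. (x, drop (length x) w)) ` {x \<in> X. take (length x) w = x} \<subseteq> splits w"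
    proof clarify
      fix x assume "take (length x) w = x"
      then have "x @ drop (length x) w = w" by (metis append_take_drop_id)
      then show "(x, drop (length x) w) \<in> splits w" by (simp add: splits_def)
    qed
    show "\<forall>i\<in>splits w - (\<lambda>x. (x, drop (length x) w)) ` {x \<in> X. take (length x) w = x}.
        (case i of (u, v) \<Rightarrow> (if u \<in> X then c u else 0) * g v) = 0"
    proof clarify
      fix u v assume "(u, v) \<in> splits w"
        and "(u, v) \<notin> (\<lambda>x. (x, drop (length x) w)) ` {x \<in> X. take (length x) w = x}"
      then have "u \<notin> X" by (auto simp: splits_def)
      then show "(if u \<in> X then c u else 0) * g v = 0" by simp
    qed
  qed
  also have "\<dots> = (\<Sum>x\<in>{x \<in> X. take (length x) w = x}. c x * g (drop (length x) w))"
    by (subst sum.reindex) (auto simp: inj_on_def)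
  also have "\<dots> = (\<Sum>x\<in>X. c x * Lop K x g w)"
    using assms by (intro sum.mono_neutral_cong_left) (auto simp: Lop_def)
  finally show ?thesis by simp
qed

lemma mult_Lspan:
  assumes "finite {w. p w \<noteq> 0}" "{w. p w \<noteq> 0} \<subseteq> words K"
  shows "mult K p \<in> Lspan K"
proof -
  have "mult K p g w = (\<Sum>x\<in>{w. p w \<noteq> 0}. p x * Lop K x g w)" for g w
  proof (cases "g \<in> l2 K")
    case True
    have "(\<lambda>x. if x \<in> {w. p w \<noteq> 0} then p x else 0) = p" by auto
    then show ?thesis
      using Lop_sum[OF assms(1) True, of p w] True by (simp add: mult_def)
  qed (simp add: mult_def Lop_def)
  then show ?thesis
    using assms unfolding Lspan_def by blast
qed

text \<open>The Fejer truncations have finite support, hence lie in \<open>Lspan\<close>, and they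
  converge strongly to the multiplier.\<close>

lemma mult_Falg:
  assumes bd: "mbound1 K f C" and supp: "\<And>w. w \<notin> words K \<Longrightarrow> f w = 0"
  shows "mult K f \<in> Falg K"
  unfolding Falg_def
proof (intro CollectI conjI allI impI mult_is_op[OF assms])
  fix X :: "(nat list \<Rightarrow> complex) set" and e :: real
  assume X: "finite X" "X \<subseteq> l2 K" and e: "0 < e"
  have "\<forall>g\<in>X. \<forall>\<^sub>F N in sequentially. nrm (\<lambda>w. conv f g w - conv (fejer K N f) g w) < e"
    using fejer_strong[OF assms _ e] X(2) by blast
  then have "\<forall>\<^sub>F N in sequentially. \<forall>g\<in>X. nrm (\<lambda>w. conv f g w - conv (fejer K N f) g w) < e"
    by (simp add: eventually_ball_finite X(1))
  then obtain N where N: "\<forall>g\<in>X. nrm (\<lambda>w. conv f g w - conv (fejer K N f) g w) < e"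
    using eventually_happens'[OF sequentially_bot] by blast
  show "\<exists>S\<in>Lspan K. \<forall>g\<in>X. nrm (\<lambda>w. mult K f g w - S g w) < e"
  proof (rule bexI[OF _ mult_Lspan[OF fejer_finite]])
    show "\<forall>g\<in>X. nrm (\<lambda>w. mult K f g w - mult K (fejer K N f) g w) < e"
      using N X(2) by (simp add: mult_def subset_iff)
  qed
qed

lemma Lop_l2: "x \<in> words K \<Longrightarrow> g \<in> l2 K \<Longrightarrow> Lop K x g \<in> l2 K"
proof (rule l2I[of _ _ "nrm g"])
  assume x: "x \<in> words K" and g: "g \<in> l2 K"
  show "Lop K x g w = 0" if "w \<notin> words K" for w
  proof -
    have "drop (length x) w \<notin> words K" if "take (length x) w = x"
      using x \<open>w \<notin> words K\<close> that words_append[of "take (length x) w" "drop (length x) w" K]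
      unfolding append_take_drop_id by simp
    then show ?thesis using l2_supp[OF g] by (auto simp: Lop_def)
  qed
  fix W :: "nat list set" assume W: "finite W"
  let ?W = "{w \<in> W. take (length x) w = x}"
  have "(\<Sum>w\<in>W. (cmod (Lop K x g w))\<^sup>2) = (\<Sum>w\<in>?W. (cmod (g (drop (length x) w)))\<^sup>2)"
    using W g by (intro sum.mono_neutral_cong_right) (auto simp: Lop_def)
  also have "\<dots> = (\<Sum>v\<in>drop (length x) ` ?W. (cmod (g v))\<^sup>2)"
  proof (subst sum.reindex)
    show "inj_on (drop (length x)) ?W"
    proof (rule inj_onI)
      fix w w' assume "w \<in> ?W" "w' \<in> ?W" "drop (length x) w = drop (length x) w'"
      then show "w = w'"
        using append_take_drop_id[of "length x" w] append_take_drop_id[of "length x" w'] by simp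
    qed
  qed simp
  also have "\<dots> \<le> (nrm g)\<^sup>2"
    using W by (intro sum_le_nrm[OF g]) auto
  finally show "(\<Sum>w\<in>W. (cmod (Lop K x g w))\<^sup>2) \<le> (nrm g)\<^sup>2" .
qed (rule nrm_nonneg)

text \<open>Approximate \<open>T\<close> on \<open>g\<close> and on \<open>vac\<close>
  simultaneously by some \<open>S\<close> in \<open>Lspan\<close>, which is convolution by a
  finitely supported \<open>p\<close>. At a fixed word convolution is a finite sum, so closeness of
  \<open>T vac\<close> and \<open>p\<close> carries over to the values on \<open>g\<close>.\<close>

lemma Falg_conv:
  assumes T: "T \<in> Falg K" and g: "g \<in> l2 K"
  shows "T g = conv (T vac) g"
proof
  fix w
  let ?s = "\<Sum>(u, v)\<in>splits w. cmod (g v)"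
  have op: "T h \<in> l2 K" if "h \<in> l2 K" for h
    using T that by (auto simp: Falg_def is_op_def)
  have "cmod (T g w - conv (T vac) g w) \<le> 0 + e" if e: "0 < e" for e
  proof -
    have s: "0 \<le> ?s" by (auto intro: sum_nonneg)
    \<comment> \<open>The total error \<open>d + d * ?s\<close> then equals
      \<open>e\<close>.\<close>
    define d where "d = e / (1 + ?s)"
    have d: "0 < d" using e s by (simp add: d_def)
    have "\<forall>X. finite X \<longrightarrow> X \<subseteq> l2 K \<longrightarrow> (\<forall>e>0. \<exists>S\<in>Lspan K. \<forall>f\<in>X. nrm (\<lambda>w. T f w - S f w) < e)"
      using T by (simp add: Falg_def)
    from this[rule_format, of "{g, vac}", OF _ _ d] g vac_l2[of K]
    obtain S where S: "S \<in> Lspan K" "\<forall>f\<in>{g, vac}. nrm (\<lambda>w. T f w - S f w) < d"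
      by blast
    then obtain X c where X: "finite X" "X \<subseteq> words K" and S_eq: "S = (\<lambda>f w. \<Sum>x\<in>X. c x * Lop K x f w)"
      unfolding Lspan_def by auto
    define p where "p x = (if x \<in> X then c x else 0)" for x
    have Sl2: "S h \<in> l2 K" if "h \<in> l2 K" for h
      unfolding S_eq using X that by (intro l2_sum l2_scale Lop_l2) auto
    have Sconv: "S h w = conv p h w" if "h \<in> l2 K" for h w
      unfolding S_eq p_def using Lop_sum[OF X(1) that] by simp
    have close: "cmod (T h w - conv p h w) \<le> d" if "h = g \<or> h = vac" for h w
    proof -
      have h: "h \<in> l2 K" using that g vac_l2 by auto
      have "cmod (T h w - S h w) \<le> nrm (\<lambda>w. T h w - S h w)"
        by (rule cmod_le_nrm[OF l2_diff[OF op[OF h] Sl2[OF h]]])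
      also have "\<dots> < d" using S(2) that by blast
      finally show ?thesis by (simp add: Sconv[OF h])
    qed
    have "cmod (T g w - conv (T vac) g w) = cmod ((T g w - conv p g w) - conv (\<lambda>w. T vac w - p w) g w)"
      by (simp add: conv_diff)
    also have "\<dots> \<le> cmod (T g w - conv p g w) + cmod (conv (\<lambda>w. T vac w - p w) g w)"
      by (rule norm_triangle_ineq4)
    also have "cmod (conv (\<lambda>w. T vac w - p w) g w) \<le> (\<Sum>(u, v)\<in>splits w. d * cmod (g v))"
      unfolding conv_def
    proof (rule sum_norm_le, clarify)
      fix u v
      show "cmod ((T vac u - p u) * g v) \<le> d * cmod (g v)"
        using close[of vac u] by (auto simp: norm_mult conv_vac intro!: mult_right_mono)
    qed
    also have "\<dots> = d * ?s"
      by (simp add: sum_distrib_left case_prod_unfold)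
    also have "cmod (T g w - conv p g w) + d * ?s \<le> d + d * ?s"
      using close[of g w] by simp
    also have "\<dots> = d * (1 + ?s)" by (simp only: distrib_left mult_1_right)
    also have "\<dots> = e" using s by (simp add: d_def)
    finally show ?thesis by simp
  qed
  then have "cmod (T g w - conv (T vac) g w) \<le> 0"
    by (rule field_le_epsilon)
  then show "T g w = conv (T vac) g w" by simp
qed

lemma Falg_l2: "T \<in> Falg K \<Longrightarrow> g \<in> l2 K \<Longrightarrow> T g \<in> l2 K"
  by (simp add: Falg_def is_op_def)

lemma Falg_supp: "T \<in> Falg K \<Longrightarrow> w \<notin> words K \<Longrightarrow> T vac w = 0"
  using l2_supp[OF Falg_l2[OF _ vac_l2]] by blast

text \<open>With \<open>mult_vac\<close> this makes coefficient functions a faithful description of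
  the algebra.\<close>

lemma Falg_mult:
  assumes "T \<in> Falg K"
  shows "mult K (T vac) = T"
proof
  fix g
  show "mult K (T vac) g = T g"
  proof (cases "g \<in> l2 K")
    case True
    then show ?thesis using Falg_conv[OF assms True] by (simp add: mult_def)
  next
    case False
    then show ?thesis using assms by (simp add: mult_def Falg_def is_op_def)
  qed
qed

lemma mult_vac: "mult K f vac = f"
  by (simp add: mult_def vac_l2 conv_vac[abs_def])

section \<open>Matrix norms\<close>

text \<open>Each row is summable because its partial sums are dominated by the sums over all rows;
  the finitely many rows can then be added.\<close>

lemma sum_infsum_le:
  fixes q :: "nat \<Rightarrow> 'a \<Rightarrow> real"
  assumes pos: "\<And>i w. 0 \<le> q i w" and le: "\<And>W. finite W \<Longrightarrow> (\<Sum>w\<in>W. \<Sum>i<n. q i w) \<le> B"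
  shows "(\<Sum>i<n. infsum (q i) UNIV) \<le> B"
proof -
  have s: "q i summable_on UNIV" if "i < n" for i
  proof (rule bounded_sums(1)[OF pos])
    fix W :: "'a set" assume W: "finite W"
    have "sum (q i) W \<le> (\<Sum>w\<in>W. \<Sum>i<n. q i w)"
      using that pos by (intro sum_mono member_le_sum) auto
    then show "sum (q i) W \<le> B" using le[OF W] by simp
  qed
  have "((\<lambda>w. \<Sum>i<m. q i w) has_sum (\<Sum>i<m. infsum (q i) UNIV)) UNIV" if "m \<le> n" for m
    using that
  proof (induction m)
    case (Suc m)
    then have "((\<lambda>w. (\<Sum>i<m. q i w) + q m w) has_sum ((\<Sum>i<m. infsum (q i) UNIV) + infsum (q m) UNIV)) UNIV"
      using s[of m] by (intro has_sum_add) auto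
    then show ?case by simp
  qed simp
  from this[OF order_refl] show ?thesis
    by (rule has_sum_le_finite_sums) (rule le)
qed

lemma mnorm_le:
  assumes bd: "mbound K n F C" and S: "\<And>i j. i < n \<Longrightarrow> j < n \<Longrightarrow> S i j = mult K (F i j)"
  shows "mnorm K n S \<le> C"
  unfolding mnorm_def
proof (rule cSup_least)
  show "{sqrt (\<Sum>i<n. (nrm (\<lambda>w. \<Sum>j<n. S i j (f j) w))\<^sup>2) |f.
      (\<forall>j<n. f j \<in> l2 K) \<and> (\<Sum>j<n. (nrm (f j))\<^sup>2) \<le> 1} \<noteq> {}"
    by (auto intro!: exI[of _ "\<lambda>_ _. 0"] simp: l2_0 nrm_0)
next
  fix x assume "x \<in> {sqrt (\<Sum>i<n. (nrm (\<lambda>w. \<Sum>j<n. S i j (f j) w))\<^sup>2) |f.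
      (\<forall>j<n. f j \<in> l2 K) \<and> (\<Sum>j<n. (nrm (f j))\<^sup>2) \<le> 1}"
  then obtain f where x: "x = sqrt (\<Sum>i<n. (nrm (\<lambda>w. \<Sum>j<n. S i j (f j) w))\<^sup>2)"
    and f: "\<And>j. j < n \<Longrightarrow> f j \<in> l2 K" "(\<Sum>j<n. (nrm (f j))\<^sup>2) \<le> 1" by blast
  have "(\<Sum>w\<in>W. \<Sum>i<n. (cmod (\<Sum>j<n. conv (F i j) (f j) w))\<^sup>2) \<le> C\<^sup>2" if "finite W" for W
  proof -
    have "C\<^sup>2 * (\<Sum>j<n. (nrm (f j))\<^sup>2) \<le> C\<^sup>2 * 1"
      by (rule mult_left_mono[OF f(2)]) simp
    then show ?thesis using mbound_l2[where g = f, OF bd f(1) that] by linarith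
  qed
  then have "(\<Sum>i<n. (nrm (\<lambda>w. \<Sum>j<n. conv (F i j) (f j) w))\<^sup>2) \<le> C\<^sup>2"
    unfolding nrm_sq by (intro sum_infsum_le) auto
  also have "(\<Sum>i<n. (nrm (\<lambda>w. \<Sum>j<n. conv (F i j) (f j) w))\<^sup>2)
      = (\<Sum>i<n. (nrm (\<lambda>w. \<Sum>j<n. S i j (f j) w))\<^sup>2)"
    by (simp add: S mult_def f(1))
  finally show "x \<le> C"
    unfolding x using mbound_nonneg[OF bd] by (simp add: real_le_lsqrt)
qed

text \<open>The converse of \<open>mnorm_le\<close>: together they identify the least constant in
  \<open>mbound\<close> with the matrix norm.\<close>

lemma mbound_mnorm:
  assumes T: "\<And>i j. i < n \<Longrightarrow> j < n \<Longrightarrow> T i j \<in> Falg K"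
  shows "mbound K n (\<lambda>i j. T i j vac) (mnorm K n T)"
proof -
  let ?X = "{sqrt (\<Sum>i<n. (nrm (\<lambda>w. \<Sum>j<n. T i j (f j) w))\<^sup>2) |f.
      (\<forall>j<n. f j \<in> l2 K) \<and> (\<Sum>j<n. (nrm (f j))\<^sup>2) \<le> 1}"
  have "\<forall>i j. \<exists>c. i < n \<longrightarrow> j < n \<longrightarrow> (\<forall>f\<in>l2 K. nrm (T i j f) \<le> c * nrm f)"
  proof (intro allI)
    fix i j
    show "\<exists>c. i < n \<longrightarrow> j < n \<longrightarrow> (\<forall>f\<in>l2 K. nrm (T i j f) \<le> c * nrm f)"
    proof (cases "i < n \<and> j < n")
      case True
      then have "is_op K (T i j)" using T by (simp add: Falg_def)
      then show ?thesis unfolding is_op_def by blast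
    qed blast
  qed
  then obtain c where c: "\<And>i j f. i < n \<Longrightarrow> j < n \<Longrightarrow> f \<in> l2 K \<Longrightarrow> nrm (T i j f) \<le> c i j * nrm f"
    by metis
  \<comment> \<open>A real \<open>Sup\<close> dominates its set only if the set is bounded;
    boundedness of the individual entries provides a crude bound.\<close>
  have bdd: "bdd_above ?X"
  proof (rule bdd_aboveI)
    fix x assume "x \<in> ?X"
    then obtain f where x: "x = sqrt (\<Sum>i<n. (nrm (\<lambda>w. \<Sum>j<n. T i j (f j) w))\<^sup>2)"
      and f: "\<And>j. j < n \<Longrightarrow> f j \<in> l2 K" "(\<Sum>j<n. (nrm (f j))\<^sup>2) \<le> 1" by blast
    have f1: "nrm (f j) \<le> 1" if "j < n" for j
    proof -
      have "(nrm (f j))\<^sup>2 \<le> (\<Sum>j<n. (nrm (f j))\<^sup>2)"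
        using that by (intro member_le_sum) auto
      then show ?thesis using f(2) nrm_nonneg[of "f j"] abs_square_le_1[of "nrm (f j)"] by simp
    qed
    have "nrm (\<lambda>w. \<Sum>j<n. T i j (f j) w) \<le> (\<Sum>j<n. \<bar>c i j\<bar>)" if i: "i < n" for i
    proof -
      have "nrm (\<lambda>w. \<Sum>j<n. T i j (f j) w) \<le> (\<Sum>j<n. nrm (T i j (f j)))"
        by (rule nrm_sum[where K = K]) (simp_all add: Falg_l2[OF T[OF i] f(1)])
      also have "\<dots> \<le> (\<Sum>j<n. \<bar>c i j\<bar>)"
      proof (rule sum_mono)
        fix j assume j: "j \<in> {..<n}"
        have "nrm (T i j (f j)) \<le> c i j * nrm (f j)" using i j by (intro c f(1)) auto
        also have "\<dots> \<le> \<bar>c i j\<bar> * 1"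
          using f1 j nrm_nonneg by (intro mult_mono) auto
        finally show "nrm (T i j (f j)) \<le> \<bar>c i j\<bar>" by simp
      qed
      finally show ?thesis .
    qed
    then show "x \<le> sqrt (\<Sum>i<n. (\<Sum>j<n. \<bar>c i j\<bar>)\<^sup>2)"
      unfolding x by (intro real_sqrt_le_mono sum_mono power_mono nrm_nonneg) auto
  qed
  have ub: "sqrt (\<Sum>i<n. (nrm (\<lambda>w. \<Sum>j<n. T i j (f j) w))\<^sup>2) \<le> mnorm K n T"
    if "\<And>j. j < n \<Longrightarrow> f j \<in> l2 K" "(\<Sum>j<n. (nrm (f j))\<^sup>2) \<le> 1" for f
    unfolding mnorm_def
  proof (rule cSup_upper[OF _ bdd])
    show "sqrt (\<Sum>i<n. (nrm (\<lambda>w. \<Sum>j<n. T i j (f j) w))\<^sup>2) \<in> ?X"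
      using that by (intro CollectI exI[of _ f]) simp
  qed
  have M: "0 \<le> mnorm K n T"
    by (rule order_trans[OF _ ub[of "\<lambda>_ _. 0"]]) (auto simp: l2_0 nrm_0 intro: sum_nonneg)
  show ?thesis
    unfolding mbound_def
  proof (intro conjI allI impI M)
    fix G :: "nat \<Rightarrow> nat list \<Rightarrow> complex" and V W :: "nat list set"
    assume V: "finite V" and W: "finite W" and VK: "V \<subseteq> words K" and G0: "\<forall>j v. v \<notin> V \<longrightarrow> G j v = 0"
    define s where "s = (\<Sum>v\<in>V. \<Sum>j<n. (cmod (G j v))\<^sup>2)"
    define h where "h i w = (\<Sum>j<n. conv (T i j vac) (G j) w)" for i w
    have G: "G j \<in> l2 K" "(nrm (G j))\<^sup>2 = (\<Sum>v\<in>V. (cmod (G j v))\<^sup>2)" for j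
      using finite_support[OF V VK, of "G j"] G0 by auto
    have s_eq: "(\<Sum>j<n. (nrm (G j))\<^sup>2) = s"
      unfolding s_def G(2) by (rule sum.swap)
    have h_eq: "h i = (\<lambda>w. \<Sum>j<n. T i j (G j) w)" if "i < n" for i
    proof
      fix w
      show "h i w = (\<Sum>j<n. T i j (G j) w)"
        unfolding h_def
      proof (rule sum.cong[OF refl])
        fix j assume "j \<in> {..<n}"
        then have "T i j (G j) = conv (T i j vac) (G j)"
          using that by (intro Falg_conv[where K = K] T G) auto
        then show "conv (T i j vac) (G j) w = T i j (G j) w" by simp
      qed
    qed
    have hl2: "h i \<in> l2 K" if "i < n" for i
      unfolding h_eq[OF that] by (rule l2_sum) (simp_all add: Falg_l2[OF T[OF that] G(1)])
    have "(\<Sum>i<n. (nrm (h i))\<^sup>2) \<le> (mnorm K n T)\<^sup>2 * s"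
    \<comment> \<open>The zero vector cannot be normalized, but then all \<open>h i\<close>
      vanish.\<close>
    proof (cases "s = 0")
      case True
      have "G j v = 0" if "j < n" for j v
      proof (cases "v \<in> V")
        case v: True
        have "(\<Sum>j<n. (cmod (G j v))\<^sup>2) = 0"
          using True v V by (simp add: s_def sum_nonneg_eq_0_iff sum_nonneg)
        then show ?thesis using that by (simp add: sum_nonneg_eq_0_iff)
      qed (use G0 in auto)
      then have "h i = (\<lambda>_. 0)" for i
        by (simp add: h_def fun_eq_iff conv_def)
      then show ?thesis using True by (simp add: nrm_0)
    next
      case False
      have "0 \<le> s" by (simp add: s_def sum_nonneg)
      with False have s: "0 < s" by simp
      \<comment> \<open>The test vector scaled to norm one, so that it is admissible in the
        supremum.\<close>
      define f where "f j w = of_real (1 / sqrt s) * G j w" for j w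
      have f: "f j \<in> l2 K" "(nrm (f j))\<^sup>2 = (nrm (G j))\<^sup>2 / s" for j
      proof -
        show "f j \<in> l2 K" unfolding f_def by (rule l2_scale[OF G(1)])
        show "(nrm (f j))\<^sup>2 = (nrm (G j))\<^sup>2 / s"
          unfolding f_def nrm_scale using s by (simp add: norm_divide power_mult_distrib power_divide)
      qed
      have "(\<lambda>w. \<Sum>j<n. T i j (f j) w) = (\<lambda>w. of_real (1 / sqrt s) * h i w)" if "i < n" for i
      proof
        fix w
        have "T i j (f j) w = of_real (1 / sqrt s) * conv (T i j vac) (G j) w" if "j < n" for j
        proof -
          have "T i j (f j) w = conv (T i j vac) (f j) w"
            using Falg_conv[OF T f(1)] \<open>i < n\<close> that by metis
          then show ?thesis by (simp only: f_def[abs_def] conv_scale_right)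
        qed
        then show "(\<Sum>j<n. T i j (f j) w) = of_real (1 / sqrt s) * h i w"
          by (simp only: h_def sum_distrib_left) (rule sum.cong, auto)
      qed
      note Tf = this
      have e: "(nrm (\<lambda>w. \<Sum>j<n. T i j (f j) w))\<^sup>2 = (nrm (h i))\<^sup>2 / s" if "i < n" for i
        unfolding Tf[OF that] nrm_scale using s
        by (simp add: norm_divide power_mult_distrib power_divide)
      have "sqrt (\<Sum>i<n. (nrm (h i))\<^sup>2 / s) \<le> mnorm K n T"
        using ub[of f] f s by (simp add: e sum_divide_distrib[symmetric] s_eq)
      then have "(\<Sum>i<n. (nrm (h i))\<^sup>2) / s \<le> (mnorm K n T)\<^sup>2"
        using sqrt_le_D by (simp add: sum_divide_distrib)
      then show ?thesis using s by (simp add: divide_le_eq)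
    qed
    moreover have "(\<Sum>w\<in>W. \<Sum>i<n. (cmod (h i w))\<^sup>2) \<le> (\<Sum>i<n. (nrm (h i))\<^sup>2)"
      using sum_le_nrm[OF hl2 W] by (subst sum.swap) (auto intro!: sum_mono)
    ultimately show "(\<Sum>w\<in>W. \<Sum>i<n. (cmod (\<Sum>j<n. conv (T i j vac) (G j) w))\<^sup>2)
        \<le> (mnorm K n T)\<^sup>2 * (\<Sum>v\<in>V. \<Sum>j<n. (cmod (G j v))\<^sup>2)"
      by (simp add: h_def s_def)
  qed
qed

section \<open>Completely bounded maps given on coefficient functions\<close>

definition cb_coef :: "enat \<Rightarrow> enat \<Rightarrow> ((nat list \<Rightarrow> complex) \<Rightarrow> (nat list \<Rightarrow> complex)) \<Rightarrow> bool" where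
  "cb_coef K M p \<longleftrightarrow>
     (\<forall>f. (\<forall>w. w \<notin> words K \<longrightarrow> f w = 0) \<longrightarrow> (\<forall>w. w \<notin> words M \<longrightarrow> p f w = 0)) \<and>
     (\<forall>f g a b. p (\<lambda>w. a * f w + b * g w) = (\<lambda>w. a * p f w + b * p g w)) \<and>
     (\<exists>c. \<forall>n F C. mbound K n F C \<longrightarrow> mbound M n (\<lambda>i j. p (F i j)) (c * C))"

text \<open>The bound for matrices of size 1 puts the image multiplier into the algebra by
  \<open>mult_Falg\<close>; for general size \<open>mbound_mnorm\<close> and \<open>mnorm_le\<close>
  translate it into a bound of matrix norms.\<close>

lemma cb_coef_lift:
  assumes "cb_coef K M p"
  defines "\<phi> \<equiv> \<lambda>T. mult M (p (T vac))"
  shows "\<forall>T\<in>Falg K. \<phi> T \<in> Falg M" "lin_on K \<phi>" "cb_map K M \<phi>"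
proof -
  from assms(1) obtain c where supp: "\<And>f w. (\<And>w. w \<notin> words K \<Longrightarrow> f w = 0) \<Longrightarrow> w \<notin> words M \<Longrightarrow> p f w = 0"
    and lin: "\<And>f g a b. p (\<lambda>w. a * f w + b * g w) = (\<lambda>w. a * p f w + b * p g w)"
    and bd: "\<And>n F C. mbound K n F C \<Longrightarrow> mbound M n (\<lambda>i j. p (F i j)) (c * C)"
    unfolding cb_coef_def by blast
  show "\<forall>T\<in>Falg K. \<phi> T \<in> Falg M"
  proof
    fix T assume T: "T \<in> Falg K"
    have "mbound K 1 (\<lambda>i j. T vac) (mnorm K 1 (\<lambda>_ _. T))"
      by (rule mbound_mnorm) (rule T)
    from bd[OF this] show "\<phi> T \<in> Falg M"
      unfolding \<phi>_def by (rule mult_Falg) (rule supp[OF Falg_supp[OF T]])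
  qed
  show "lin_on K \<phi>"
    by (auto simp: lin_on_def \<phi>_def op_lincomb_def mult_def lin fun_eq_iff conv_add conv_scale)
  show "cb_map K M \<phi>"
    unfolding cb_map_def
  proof (intro exI[of _ c] allI impI)
    fix n :: nat and T :: "nat \<Rightarrow> nat \<Rightarrow> op" assume "\<forall>i<n. \<forall>j<n. T i j \<in> Falg K"
    then have "mbound K n (\<lambda>i j. T i j vac) (mnorm K n T)"
      by (intro mbound_mnorm) auto
    then show "mnorm M n (\<lambda>i j. \<phi> (T i j)) \<le> c * mnorm K n T"
      by (intro mnorm_le[OF bd[of n "\<lambda>i j. T i j vac"]]) (simp_all add: \<phi>_def)
  qed
qed

lemma completely_isomorphicI:
  assumes "cb_coef K M p" "cb_coef M K q"
    and qp: "\<And>f. (\<And>w. w \<notin> words K \<Longrightarrow> f w = 0) \<Longrightarrow> q (p f) = f"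
    and pq: "\<And>f. (\<And>w. w \<notin> words M \<Longrightarrow> f w = 0) \<Longrightarrow> p (q f) = f"
  shows "completely_isomorphic K M"
  unfolding completely_isomorphic_def
proof (rule exI[of _ "\<lambda>T. mult M (p (T vac))"], rule exI[of _ "\<lambda>T. mult K (q (T vac))"], intro conjI)
  show "\<forall>T\<in>Falg K. mult K (q (mult M (p (T vac)) vac)) = T"
  proof
    fix T assume T: "T \<in> Falg K"
    have "q (p (T vac)) = T vac" by (rule qp) (rule Falg_supp[OF T])
    then show "mult K (q (mult M (p (T vac)) vac)) = T" by (simp add: mult_vac Falg_mult[OF T])
  qed
  show "\<forall>T\<in>Falg M. mult M (p (mult K (q (T vac)) vac)) = T"
  proof
    fix T assume T: "T \<in> Falg M"
    have "p (q (T vac)) = T vac" by (rule pq) (rule Falg_supp[OF T])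
    then show "mult M (p (mult K (q (T vac)) vac)) = T" by (simp add: mult_vac Falg_mult[OF T])
  qed
qed (simp_all add: cb_coef_lift[OF assms(1)] cb_coef_lift[OF assms(2)])

section \<open>The Hilbert hotel along a prefix code\<close>

lemma code_block_mono:
  assumes "code_block A \<iota> I y" "J \<subseteq> I"
  shows "code_block A \<iota> J y"
proof -
  interpret code_block A \<iota> I y by (rule assms)
  show ?thesis
  proof (unfold_locales, fact hom, fact inj, fact pre)
    fix l s t u assume "l \<in> J" "s \<in> words A" "t \<in> words A" "u @ \<iota> t = y l @ \<iota> s"
    then show "\<exists>p\<in>words A. u = y l @ \<iota> p"
      using assms(2) by (intro suf[of l s t]) auto
  next
    fix l m a b assume "l \<in> J" "m \<in> J" "y l @ a = y m @ b"
    then show "l = m"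
      using assms(2) by (intro ypre[of l m a b]) auto
  qed
qed

lemma code_block_Suc:
  assumes "code_block A \<iota> UNIV y"
  shows "code_block A \<iota> UNIV (\<lambda>l. y (Suc l))"
proof -
  interpret code_block A \<iota> UNIV y by (rule assms)
  show ?thesis
  proof (unfold_locales, fact hom, fact inj, fact pre)
    fix l s t u assume "s \<in> words A" "t \<in> words A" "u @ \<iota> t = y (Suc l) @ \<iota> s"
    then show "\<exists>p\<in>words A. u = y (Suc l) @ \<iota> p"
      by (intro suf[of "Suc l" s t]) auto
  next
    fix l m a b assume "y (Suc l) @ a = y (Suc m) @ b"
    then show "l = m"
      using ypre[of "Suc l" "Suc m" a b] by simp
  qed
qed

text \<open>Infinitely many rows \<open>y l\<close>, each carrying a copy of \<open>words A\<close>
  inside \<open>words K\<close>.\<close>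

locale shift_code = code_block A \<iota> UNIV y for A \<iota> y +
  fixes K :: enat
  assumes emb: "s \<in> words A \<Longrightarrow> \<iota> s \<in> words K" and y_words: "y l \<in> words K"
begin

definition code :: "nat list set" where
  "code = {y l @ \<iota> s | l s. s \<in> words A}"

lemma code_eq: "s \<in> words A \<Longrightarrow> t \<in> words A \<Longrightarrow> y l @ \<iota> s = y m @ \<iota> t \<longleftrightarrow> l = m \<and> s = t"
  using ypre[of l m "\<iota> s" "\<iota> t"] inj by auto

text \<open>The hotel shift, which vacates row 0. The description under \<open>THE\<close>
  determines one word by \<open>code_eq\<close>.\<close>

definition up :: "nat list \<Rightarrow> nat list" where
  "up w = (if w \<in> code then THE x. \<exists>l. \<exists>s\<in>words A. w = y l @ \<iota> s \<and> x = y (Suc l) @ \<iota> s else w)"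

lemma up_code: "s \<in> words A \<Longrightarrow> up (y l @ \<iota> s) = y (Suc l) @ \<iota> s"
  unfolding up_def by (auto simp: code_eq code_def intro!: the_equality)

lemma up_id: "w \<notin> code \<Longrightarrow> up w = w"
  by (simp add: up_def)

lemma word_cases [case_names id code]:
  obtains "w \<notin> code" | l s where "s \<in> words A" "w = y l @ \<iota> s"
  by (auto simp: code_def)

lemma in_code: "s \<in> words A \<Longrightarrow> y l @ \<iota> s \<in> code"
  by (auto simp: code_def)

lemma inj_up: "inj up"
proof (rule injI)
  fix v w assume "up v = up w"
  then show "v = w"
    by (cases v rule: word_cases; cases w rule: word_cases)
      (auto simp: up_id up_code code_eq in_code)
qed

definition head :: "nat list set" where
  "head = (\<lambda>s. y 0 @ \<iota> s) ` words A"

lemma up_not_head: "up w \<notin> head"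
  by (cases w rule: word_cases) (auto simp: up_id up_code head_def code_eq in_code)

lemma inv_up_code: "s \<in> words A \<Longrightarrow> inv up (y (Suc l) @ \<iota> s) = y l @ \<iota> s"
  using inv_f_f[OF inj_up, of "y l @ \<iota> s"] by (simp add: up_code)

text \<open>With \<open>up_not_head\<close>, the vacated row and the range of \<open>up\<close>
  partition all words, so \<open>glue\<close> uses \<open>inv up\<close> only where it is
  meaningful.\<close>

lemma head_or_up: "w \<in> head \<or> w \<in> range up"
proof (cases w rule: word_cases)
  case id
  then show ?thesis by (metis up_id rangeI)
next
  case (code l s)
  then show ?thesis
    by (cases l) (auto simp: head_def up_code[symmetric])
qed

text \<open>The word bijection behind \<open>X\<^sub>K \<simeq> X\<^sub>A \<oplus> X\<^sub>K\<close> is \<open>f \<mapsto> (peel f, f \<circ> up)\<close>, with inverse \<open>glue\<close>.\<close>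

definition peel :: "(nat list \<Rightarrow> complex) \<Rightarrow> nat list \<Rightarrow> complex" where
  "peel f s = (if s \<in> words A then f (y 0 @ \<iota> s) else 0)"

definition glue :: "(nat list \<Rightarrow> complex) \<Rightarrow> (nat list \<Rightarrow> complex) \<Rightarrow> nat list \<Rightarrow> complex" where
  "glue g f w = (if w \<in> head then g (inv_into (words A) (\<lambda>s. y 0 @ \<iota> s) w) else f (inv up w))"

lemma glue_head: "s \<in> words A \<Longrightarrow> glue g f (y 0 @ \<iota> s) = g s"
  unfolding glue_def head_def by (subst inv_into_f_f) (auto simp: inj_on_def inj)

lemma glue_up: "glue g f (up w) = f w"
  by (simp add: glue_def up_not_head inj_up)

lemma peel_glue: "(\<And>w. w \<notin> words A \<Longrightarrow> g w = 0) \<Longrightarrow> peel (glue g f) = g"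
  by (auto simp: fun_eq_iff peel_def glue_head)

lemma glue_comp_up: "glue g f \<circ> up = f"
  by (auto simp: glue_up)

lemma glue_peel: "glue (peel f) (f \<circ> up) = f"
proof
  fix w
  from head_or_up[of w] show "glue (peel f) (f \<circ> up) w = f w"
    by (auto simp: head_def glue_head glue_up peel_def)
qed

lemma peel_supp: "w \<notin> words A \<Longrightarrow> peel f w = 0"
  by (simp add: peel_def)

lemma comp_up_supp:
  assumes "\<And>w. w \<notin> words K \<Longrightarrow> f w = 0" "w \<notin> words K"
  shows "(f \<circ> up) w = 0"
  using assms emb y_words by (cases w rule: word_cases) (auto simp: up_id)

lemma glue_supp:
  assumes "\<And>w. w \<notin> words K \<Longrightarrow> f w = 0" "w \<notin> words K"
  shows "glue g f w = 0"
proof -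
  have w: "w \<notin> code" using assms(2) emb y_words by (auto simp: code_def)
  then have "glue g f w = f w" using glue_up[of g f w] by (simp add: up_id)
  with assms show ?thesis by simp
qed

lemma peel_lin: "peel (\<lambda>w. a * f w + b * g w) = (\<lambda>w. a * peel f w + b * peel g w)"
  by (auto simp: peel_def)

lemma glue_lin:
  "glue (\<lambda>w. a * f w + b * g w) (\<lambda>w. a * f' w + b * g' w) = (\<lambda>w. a * glue f f' w + b * glue g g' w)"
  by (auto simp: glue_def)

lemma zero_block: "code_block A \<iota> {0} y"
  using code_block_axioms by (rule code_block_mono) simp

lemma mbound_peel:
  assumes "mbound K n F C"
  shows "mbound M n (\<lambda>i j. peel (F i j)) C"
  \<comment> \<open>Row 0 is transferred to the identity code. The alphabet \<open>M\<close> is free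
    because the transfer factorizes arbitrary input words.\<close>
  by (rule mbound_transfer[OF zero_block code_block_id[OF refl] emb assms]) (auto simp: peel_def)

text \<open>Restriction to the code is a transfer of the block to itself; the complementary
  restriction is a difference and costs \<open>C + C\<close>.\<close>

lemma mbound_off_code:
  assumes "mbound K n F C"
  shows "mbound K n (\<lambda>i j w. if w \<in> code then 0 else F i j w) (C + C)"
proof -
  have "mbound K n (\<lambda>i j w. if w \<in> code then F i j w else 0) C"
    by (rule mbound_transfer[OF code_block_axioms code_block_axioms emb assms]) (auto simp: code_def)
  from mbound_diff[OF assms this] show ?thesis
    by (rule back_subst[where P = "\<lambda>F. mbound K n F (C + C)"]) (auto simp: fun_eq_iff)
qed

text \<open>Off the code nothing moves, at cost \<open>C + C\<close>; on the code the rows from 1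
  onwards are transferred to all rows, at cost \<open>C\<close>.\<close>

lemma mbound_comp_up:
  assumes "mbound K n F C"
  shows "mbound K n (\<lambda>i j. F i j \<circ> up) (3 * C)"
proof -
  have "mbound K n (\<lambda>i j w. if w \<in> code then F i j (up w) else 0) C"
    by (rule mbound_transfer[OF code_block_Suc[OF code_block_axioms] code_block_axioms emb assms])
      (auto simp: code_def up_code)
  from mbound_add[OF mbound_off_code[OF assms] this] show ?thesis
    by (rule back_subst[where P = "\<lambda>B. B"])
      (intro arg_cong2[where f = "mbound K n"], auto simp: fun_eq_iff up_id)
qed

text \<open>Three pieces with disjoint supports: the complement of the code, the rows from 1 onwards
  pulled back by the shift, and row 0, which receives \<open>G\<close>.\<close>

lemma mbound_glue:
  assumes G: "mbound A n G C'" and F: "mbound K n F C"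
  shows "mbound K n (\<lambda>i j. glue (G i j) (F i j)) (3 * C + C')"
proof -
  define tail where "tail = {y (Suc l) @ \<iota> s | l s. s \<in> words A}"
  have mb_tail: "mbound K n (\<lambda>i j w. if w \<in> tail then F i j (inv up w) else 0) C"
    by (rule mbound_transfer[OF code_block_axioms code_block_Suc[OF code_block_axioms] emb F])
      (auto simp: inv_up_code tail_def)
  have mb_head: "mbound K n (\<lambda>i j w. if w \<in> head then G i j (inv_into (words A) (\<lambda>s. y 0 @ \<iota> s) w) else 0) C'"
  proof (rule mbound_transfer[OF code_block_id[OF refl] zero_block _ G])
    fix i j l s assume *: "l \<in> {0 :: nat}" "s \<in> words A"
    then have "inv_into (words A) (\<lambda>s. y 0 @ \<iota> s) (y 0 @ \<iota> s) = s"
      by (intro inv_into_f_f) (auto simp: inj_on_def inj)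
    with * show "(if y l @ \<iota> s \<in> head then G i j (inv_into (words A) (\<lambda>s. y 0 @ \<iota> s) (y l @ \<iota> s)) else 0)
        = G i j ([] @ s)"
      by (auto simp: head_def)
  qed (auto simp: head_def)
  have "(if w \<in> code then 0 else F i j w) + (if w \<in> tail then F i j (inv up w) else 0)
      + (if w \<in> head then G i j (inv_into (words A) (\<lambda>s. y 0 @ \<iota> s) w) else 0) = glue (G i j) (F i j) w" for i j w
  proof (cases w rule: word_cases)
    case id
    then have "w \<notin> tail" "w \<notin> head" "inv up w = w"
      using inv_f_f[OF inj_up, of w] by (auto simp: code_def head_def tail_def up_id)
    with id show ?thesis by (simp add: glue_def)
  next
    case (code l s)
    then have "w \<in> code" "w \<in> tail \<longleftrightarrow> l \<noteq> 0" "w \<in> head \<longleftrightarrow> l = 0"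
      using code_eq by (auto simp: in_code head_def tail_def gr0_conv_Suc)
    then show ?thesis by (simp add: glue_def)
  qed
  with mbound_add[OF mbound_add[OF mbound_off_code[OF F] mb_tail] mb_head] show ?thesis
    by (simp add: algebra_simps)
qed

end

text \<open>Decompose over \<open>K\<close> by \<open>S\<close>, exchange the two summands, and
  reassemble over \<open>M\<close> by \<open>T\<close>. The head receives bound \<open>3 * C\<close>
  and the rest \<open>C\<close>, which yields the constant 6.\<close>

lemma cb_coef_swap:
  assumes "shift_code M \<iota> y K" "shift_code K \<kappa> z M"
  shows "cb_coef K M (\<lambda>f. shift_code.glue K \<kappa> z (f \<circ> shift_code.up M \<iota> y) (shift_code.peel M \<iota> y f))"
proof -
  interpret S: shift_code M \<iota> y K by (rule assms)
  interpret T: shift_code K \<kappa> z M by (rule assms)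
  show ?thesis
    unfolding cb_coef_def
  proof (intro conjI allI impI exI[of _ 6])
    fix n F C assume "mbound K n F C"
    from T.mbound_glue[OF S.mbound_comp_up[OF this] S.mbound_peel[OF this]]
    show "mbound M n (\<lambda>i j. T.glue (F i j \<circ> S.up) (S.peel (F i j))) (6 * C)"
      by simp
  next
    fix f :: "nat list \<Rightarrow> complex" and w assume "\<forall>w. w \<notin> words K \<longrightarrow> f w = 0" "w \<notin> words M"
    then show "T.glue (f \<circ> S.up) (S.peel f) w = 0"
      by (intro T.glue_supp S.peel_supp)
  next
    fix f g :: "nat list \<Rightarrow> complex" and a b
    show "T.glue ((\<lambda>w. a * f w + b * g w) \<circ> S.up) (S.peel (\<lambda>w. a * f w + b * g w))
      = (\<lambda>w. a * T.glue (f \<circ> S.up) (S.peel f) w + b * T.glue (g \<circ> S.up) (S.peel g) w)"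
      using T.glue_lin[of a "f \<circ> S.up" b "g \<circ> S.up" "S.peel f" "S.peel g"]
      by (simp add: S.peel_lin o_def)
  qed
qed

text \<open>The swap in the other direction, with the two codes exchanged, is the inverse: the inner
  \<open>peel\<close> and shift undo \<open>glue\<close>, and the outer \<open>glue\<close>
  reassembles the original function.\<close>

lemma shift_code_completely_isomorphic:
  assumes "shift_code M \<iota> y K" "shift_code K \<kappa> z M"
  shows "completely_isomorphic K M"
proof -
  interpret S: shift_code M \<iota> y K by (rule assms)
  interpret T: shift_code K \<kappa> z M by (rule assms)
  show ?thesis
  proof (rule completely_isomorphicI[OF cb_coef_swap[OF assms] cb_coef_swap[OF assms(2,1)]])
    fix f :: "nat list \<Rightarrow> complex" assume "\<And>w. w \<notin> words K \<Longrightarrow> f w = 0"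
    then have "T.peel (T.glue (f \<circ> S.up) (S.peel f)) = f \<circ> S.up"
      by (intro T.peel_glue S.comp_up_supp)
    then show "S.glue (T.glue (f \<circ> S.up) (S.peel f) \<circ> T.up) (T.peel (T.glue (f \<circ> S.up) (S.peel f))) = f"
      by (simp only: T.glue_comp_up S.glue_peel)
  next
    fix f :: "nat list \<Rightarrow> complex" assume "\<And>w. w \<notin> words M \<Longrightarrow> f w = 0"
    then have "S.peel (S.glue (f \<circ> T.up) (T.peel f)) = f \<circ> T.up"
      by (intro S.peel_glue T.comp_up_supp)
    then show "T.glue (S.glue (f \<circ> T.up) (T.peel f) \<circ> S.up) (S.peel (S.glue (f \<circ> T.up) (T.peel f))) = f"
      by (simp only: S.glue_comp_up T.glue_peel)
  qed
qed

section \<open>The two concrete codes\<close>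

lemma words_infinity [simp]: "words \<infinity> = UNIV"
  by (simp add: words_def)

lemma shift_code_letters: "shift_code (enat k) (\<lambda>s. s) (\<lambda>l. [k + l]) \<infinity>"
proof unfold_locales
  fix l s t u assume t: "t \<in> words (enat k)" and s: "s \<in> words (enat k)" and e: "u @ t = [k + l] @ s"
  then show "\<exists>p\<in>words (enat k). u = [k + l] @ p"
    \<comment> \<open>An empty \<open>u\<close> would put the letter \<open>k + l\<close> into
      \<open>t\<close>, although it lies outside the alphabet of size \<open>k\<close>.\<close>
    by (cases u) (auto simp: words_def)
qed auto

definition code_word :: "nat \<Rightarrow> nat list" where
  "code_word i = 0 # replicate i 1 @ [0]"

text \<open>The first 0 on each side marks the end of the block of ones.\<close>

lemma replicate_one_zero: "replicate l (1 :: nat) @ 0 # a = replicate m 1 @ 0 # b \<Longrightarrow> l = m \<and> a = b"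
proof (induction l arbitrary: m)
  case 0
  then show ?case by (cases m) auto
next
  case (Suc l)
  then show ?case by (cases m) auto
qed

lemma code_word_prefix: "code_word i @ a = code_word j @ b \<Longrightarrow> i = j \<and> a = b"
  using replicate_one_zero[of i a j b] by (simp add: code_word_def)

lemma rev_code_word [simp]: "rev (code_word i) = code_word i"
  by (simp add: code_word_def)

text \<open>Code words are palindromes, so reversal reduces the claim to the prefix
  property.\<close>

lemma code_word_suffix:
  assumes "a @ code_word i = b @ code_word j"
  shows "i = j \<and> a = b"
proof -
  have "code_word i @ rev a = code_word j @ rev b"
    using arg_cong[OF assms, of rev] by simp
  then show ?thesis using code_word_prefix[of i "rev a" j "rev b"] by simp
qed

abbreviation code_hom :: "nat list \<Rightarrow> nat list" where
  "code_hom s \<equiv> concat (map code_word s)"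

text \<open>Decoding from the left: the prefix property forces the leading code words to agree one
  after another.\<close>

lemma code_hom_prefix: "code_hom s @ x = code_hom t \<Longrightarrow> \<exists>p. t = s @ p \<and> x = code_hom p"
proof (induction s arbitrary: t)
  case (Cons a s)
  then obtain b t' where t: "t = b # t'" by (cases t) (auto simp: code_word_def)
  with Cons.prems have "a = b" "code_hom s @ x = code_hom t'"
    using code_word_prefix[of a "code_hom s @ x" b "code_hom t'"] by auto
  from Cons.IH[OF this(2)] obtain p where "t' = s @ p \<and> x = code_hom p" by blast
  with t \<open>a = b\<close> show ?case by simp
qed simp

text \<open>Decoding from the right; this supplies \<open>suf\<close> for the rows formed by ones
  followed by a single 0.\<close>

lemma code_hom_suffix:
  "u @ code_hom t = replicate l 1 @ 0 # code_hom s \<Longrightarrow> \<exists>p. u = replicate l 1 @ 0 # code_hom p"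
proof (induction t arbitrary: s rule: rev_induct)
  case (snoc a t)
  then have e: "(u @ code_hom t) @ code_word a = replicate l 1 @ 0 # code_hom s" by simp
  show ?case
  proof (cases s rule: rev_cases)
    \<comment> \<open>A code word contains two zeros and cannot be a suffix of ones followed by a
      single 0.\<close>
    case Nil
    with e have "((u @ code_hom t) @ 0 # replicate a 1) @ [0] = replicate l 1 @ [0]"
      by (simp add: code_word_def)
    then have "(u @ code_hom t) @ 0 # replicate a 1 = replicate l 1"
      by (simp only: append_same_eq)
    from arg_cong[OF this, of set] have "0 \<in> set (replicate l (1 :: nat))"
      by (metis UnI2 list.set_intros(1) set_append)
    then show ?thesis by simp
  next
    case (snoc s' b)
    with e have "(u @ code_hom t) @ code_word a = (replicate l 1 @ 0 # code_hom s') @ code_word b" by simp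
    then have "u @ code_hom t = replicate l 1 @ 0 # code_hom s'" by (rule code_word_suffix[THEN conjunct2])
    then show ?thesis by (rule snoc.IH)
  qed
next
  case Nil
  then show ?case by (intro exI[of _ s]) simp
qed

lemma shift_code_binary:
  assumes "2 \<le> k"
  shows "shift_code \<infinity> code_hom (\<lambda>l. replicate l 1 @ [0]) (enat k)"
proof unfold_locales
  fix s t :: "nat list"
  show "code_hom s = code_hom t \<longleftrightarrow> s = t"
  proof
    assume "code_hom s = code_hom t"
    then obtain p where p: "t = s @ p" "[] = code_hom p"
      using code_hom_prefix[of s "[]" t] by auto
    then show "s = t" by (cases p) (auto simp: code_word_def)
  qed simp
  show "code_hom s @ x = code_hom t \<Longrightarrow> \<exists>p\<in>words \<infinity>. x = code_hom p" for x
    using code_hom_prefix[of s x t] by auto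
  show "u @ code_hom t = (replicate l 1 @ [0]) @ code_hom s \<Longrightarrow>
      \<exists>p\<in>words \<infinity>. u = (replicate l 1 @ [0]) @ code_hom p" for u l
    using code_hom_suffix[of u t l s] by auto
  show "(replicate l 1 @ [0]) @ a = (replicate m 1 @ [0]) @ b \<Longrightarrow> l = m" for l m and a b :: "nat list"
    using replicate_one_zero[of l a m b] by auto
qed (use assms in \<open>auto simp: words_def code_word_def\<close>)

theorem theorem11:
  fixes k :: nat
  assumes "k \<ge> 2"
  shows "completely_isomorphic (enat k) \<infinity>"
  using shift_code_binary[OF assms] shift_code_letters by (rule shift_code_completely_isomorphic)

end
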